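(* Let $R$ be a unital associative superalgebra over $\Bbbk$ and $n\geqslant 3$. Then the second homology (with trivial coefficients $\Bbbk$) of the special queer Lie superalgebra satisfies $\mathrm{H}_2(\mathfrak{sq}_n(R))\cong\mathrm{HC}_1(R)\otimes\Bbbk^{0|1}$.
   Context: $\Bbbk$ is a unital commutative associative ring in which $2$ is invertible; $|x|$ denotes parity. $\mathfrak{gl}_{n|n}(R)$ is the Lie superalgebra of $2n\times 2n$ matrices over $R$ with matrix unit $e_{ij}(a)$ of parity $|i|+|j|+|a|$ ($|i|=0$ for $i\leqslant n$, $|i|=1$ for $i>n$) and bracket $[X,Y]=XY-(-1)^{|X||Y|}YX$. For homogeneous $a\in R$, $\rho(a)=(-1)^{|a|}a$ (extended linearly), applied entrywise to matrices. $\mathfrak{q}_n(R)=\left\{\begin{pmatrix}A&B\\\rho(B)&\rho(A)\end{pmatrix}: A,B\in \mathrm{M}_n(R)\right\}\subseteq\mathfrak{gl}_{n|n}(R)$ and $\mathfrak{sq}_n(R)=[\mathfrak{q}_n(R),\mathfrak{q}_n(R)]$. Let $I_R\subseteq R\otimes R$ be the $\Bbbk$-submodule generated by $a\otimes b+(-1)^{|a||b|}b\otimes a$ and $(-1)^{|a||c|}ab\otimes c+(-1)^{|b||a|}bc\otimes a+(-1)^{|c||b|}ca\otimes b$ for homogeneous $a,b,c\in R$, $\langle R,R\rangle=(R\otimes R)/I_R$ with $\boldsymbol{\lambda}(a,b)$ the image of $a\otimes b$, and $\mathrm{HC}_1(R)=\{\sum_i\boldsymbol{\lambda}(a_i,b_i):\sum_i(a_ib_i-(-1)^{|a_i||b_i|}b_ia_i)=0\}$.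 $\Bbbk^{0|1}$ is the graded module with zero even part and odd part $\Bbbk$, so $M\otimes\Bbbk^{0|1}$ is $M$ with parity reversed. *)

theory Defs
  imports Main "HOL-Library.Function_Algebras"
begin

text \<open>Parities are booleans: False = even, True = odd.
  ssign p q x = (-1)^(p q) x.\<close>
definition ssign :: "bool \<Rightarrow> bool \<Rightarrow> 'a::ab_group_add \<Rightarrow> 'a" where
  "ssign p q x = (if p \<and> q then - x else x)"

definition hom :: "'m set \<Rightarrow> 'm set \<Rightarrow> bool \<Rightarrow> 'm \<Rightarrow> bool" where
  "hom E Od p a = (if p then a \<in> Od else a \<in> E)"

definition proj :: "'m::ab_group_add set \<Rightarrow> 'm set \<Rightarrow> bool \<Rightarrow> 'm \<Rightarrow> 'm" where
  "proj E Od p a = (THE b. hom E Od p b \<and> hom E Od (\<not> p) (a - b))"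

inductive_set kspan :: "('k \<Rightarrow> 'm \<Rightarrow> 'm) \<Rightarrow> 'm set \<Rightarrow> 'm::ab_group_add set"
  for sc :: "'k \<Rightarrow> 'm \<Rightarrow> 'm" and G :: "'m set" where
  zero: "0 \<in> kspan sc G"
| gen: "g \<in> G \<Longrightarrow> g \<in> kspan sc G"
| add: "x \<in> kspan sc G \<Longrightarrow> y \<in> kspan sc G \<Longrightarrow> x + y \<in> kspan sc G"
| smul: "x \<in> kspan sc G \<Longrightarrow> sc r x \<in> kspan sc G"

definition scomm :: "'m set \<Rightarrow> 'm set \<Rightarrow> ('m \<Rightarrow> 'm \<Rightarrow> 'm) \<Rightarrow> 'm \<Rightarrow> 'm \<Rightarrow> 'm::ab_group_add" where
  "scomm E Od mul a b =
     (\<Sum>p\<in>UNIV. \<Sum>q\<in>UNIV. mul (proj E Od p a) (proj E Od q b)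
                           - ssign p q (mul (proj E Od q b) (proj E Od p a)))"

definition superalgebra :: "('k::comm_ring_1 \<Rightarrow> 'r::ring \<Rightarrow> 'r) \<Rightarrow> 'r \<Rightarrow> 'r set \<Rightarrow> 'r set \<Rightarrow> bool" where
  "superalgebra sc e R0 R1 \<longleftrightarrow>
     (\<forall>a b x. sc a (sc b x) = sc (a * b) x) \<and> (\<forall>x. sc 1 x = x)
   \<and> (\<forall>a x y. sc a (x + y) = sc a x + sc a y) \<and> (\<forall>a b x. sc (a + b) x = sc a x + sc b x)
   \<and> (\<forall>r a b. sc r (a * b) = sc r a * b \<and> sc r (a * b) = a * sc r b)
   \<and> (\<forall>a. e * a = a \<and> a * e = a)
   \<and> (\<forall>S\<in>{R0, R1}. 0 \<in> S \<and> (\<forall>a\<in>S. \<forall>b\<in>S. a + b \<in> S) \<and> (\<forall>r. \<forall>a\<in>S. sc r a \<in> S))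
   \<and> R0 \<inter> R1 = {0}
   \<and> (\<forall>a. \<exists>x\<in>R0. \<exists>y\<in>R1. a = x + y)
   \<and> e \<in> R0
   \<and> (\<forall>p q a b. hom R0 R1 p a \<longrightarrow> hom R0 R1 q b \<longrightarrow> hom R0 R1 (p \<noteq> q) (a * b))"

definition fsc :: "'k::comm_ring_1 \<Rightarrow> ('x \<Rightarrow> 'k) \<Rightarrow> ('x \<Rightarrow> 'k)" where
  "fsc r f = (\<lambda>i. r * f i)"

definition tns :: "'m \<Rightarrow> 'm \<Rightarrow> ('m \<times> 'm \<Rightarrow> 'k::comm_ring_1)" where
  "tns a b = (\<lambda>x. if x = (a, b) then 1 else 0)"

definition pairs_mod :: "'m set \<Rightarrow> ('m \<times> 'm \<Rightarrow> 'k::comm_ring_1) set" where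
  "pairs_mod C = kspan fsc {tns a b | a b. a \<in> C \<and> b \<in> C}"

definition pairs_deg :: "'m set \<Rightarrow> 'm set \<Rightarrow> 'm set \<Rightarrow> bool \<Rightarrow> ('m \<times> 'm \<Rightarrow> 'k::comm_ring_1) set" where
  "pairs_deg C E Od p = kspan fsc {tns a b | a b q s.
      a \<in> C \<and> b \<in> C \<and> hom E Od q a \<and> hom E Od s b \<and> p = (q \<noteq> s)}"

text \<open>Relations making the free module into the tensor product C (x)_k C.\<close>
definition bilin_rels :: "'m::ab_group_add set \<Rightarrow> ('k::comm_ring_1 \<Rightarrow> 'm \<Rightarrow> 'm) \<Rightarrow> ('m \<times> 'm \<Rightarrow> 'k) set" where
  "bilin_rels C sc =
     {tns (a + b) c - tns a c - tns b c | a b c. a \<in> C \<and> b \<in> C \<and> c \<in> C}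
   \<union> {tns a (b + c) - tns a b - tns a c | a b c. a \<in> C \<and> b \<in> C \<and> c \<in> C}
   \<union> {tns (sc r a) b - fsc r (tns a b) | r a b. a \<in> C \<and> b \<in> C}
   \<union> {tns a (sc r b) - fsc r (tns a b) | r a b. a \<in> C \<and> b \<in> C}"

definition cyc_rels :: "'m set \<Rightarrow> 'm set \<Rightarrow> 'm set \<Rightarrow> ('m \<Rightarrow> 'm \<Rightarrow> 'm) \<Rightarrow> ('m \<times> 'm \<Rightarrow> 'k::comm_ring_1) set" where
  "cyc_rels C E Od mul =
     {tns a b + fsc (ssign p q 1) (tns b a) | a b p q.
        a \<in> C \<and> b \<in> C \<and> hom E Od p a \<and> hom E Od q b}
   \<union> {fsc (ssign p s 1) (tns (mul a b) c) + fsc (ssign q p 1) (tns (mul b c) a)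
        + fsc (ssign s q 1) (tns (mul c a) b) | a b c p q s.
        a \<in> C \<and> b \<in> C \<and> c \<in> C \<and> hom E Od p a \<and> hom E Od q b \<and> hom E Od s c}"

text \<open>Submodule of the free module whose quotient is <C,C>.\<close>
definition lam_rels :: "'m::ab_group_add set \<Rightarrow> ('k::comm_ring_1 \<Rightarrow> 'm \<Rightarrow> 'm) \<Rightarrow> 'm set \<Rightarrow> 'm set
      \<Rightarrow> ('m \<Rightarrow> 'm \<Rightarrow> 'm) \<Rightarrow> ('m \<times> 'm \<Rightarrow> 'k) set" where
  "lam_rels C sc E Od mul = kspan fsc (bilin_rels C sc \<union> cyc_rels C E Od mul)"

definition lin_ext :: "('k \<Rightarrow> 'n \<Rightarrow> 'n) \<Rightarrow> ('m \<Rightarrow> 'm \<Rightarrow> 'n::ab_group_add) \<Rightarrow> ('m \<times> 'm \<Rightarrow> 'k::zero) \<Rightarrow> 'n" where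
  "lin_ext sc \<phi> t = (\<Sum>x\<in>{x. t x \<noteq> 0}. sc (t x) (\<phi> (fst x) (snd x)))"

text \<open>Representatives of the kernel of  lambda(a,b) |-> phi a b.\<close>
definition cycle_set :: "'m set \<Rightarrow> ('k \<Rightarrow> 'n \<Rightarrow> 'n) \<Rightarrow> ('m \<Rightarrow> 'm \<Rightarrow> 'n::ab_group_add)
      \<Rightarrow> ('m \<times> 'm \<Rightarrow> 'k::comm_ring_1) set" where
  "cycle_set C sc \<phi> = {t \<in> pairs_mod C. lin_ext sc \<phi> t = 0}"

text \<open>Z1/J1 and Z2/J2 (J_i \<subseteq> Z_i), graded by the classes of D1 p, D2 p.
  An isomorphism of k-modules Z1/J1 \<cong> Z2/J2 given on representatives by f,
  sending parity p to parity (not p), i.e.  Z1/J1 \<cong> (Z2/J2) (x) k^(0|1).\<close>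
definition graded_iso_shift :: "('x \<Rightarrow> 'k::comm_ring_1) set \<Rightarrow> ('x \<Rightarrow> 'k) set \<Rightarrow> (bool \<Rightarrow> ('x \<Rightarrow> 'k) set)
      \<Rightarrow> ('y \<Rightarrow> 'k) set \<Rightarrow> ('y \<Rightarrow> 'k) set \<Rightarrow> (bool \<Rightarrow> ('y \<Rightarrow> 'k) set) \<Rightarrow> bool" where
  "graded_iso_shift Z1 J1 D1 Z2 J2 D2 \<longleftrightarrow>
    (\<exists>f. (\<forall>x\<in>Z1. f x \<in> Z2)
       \<and> (\<forall>x\<in>Z1. \<forall>y\<in>Z1. f (x + y) - f x - f y \<in> J2)
       \<and> (\<forall>r. \<forall>x\<in>Z1. f (fsc r x) - fsc r (f x) \<in> J2)
       \<and> (\<forall>x\<in>Z1. \<forall>y\<in>Z1. f x - f y \<in> J2 \<longleftrightarrow> x - y \<in> J1)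
       \<and> (\<forall>z\<in>Z2. \<exists>x\<in>Z1. f x - z \<in> J2)
       \<and> (\<forall>p. \<forall>x\<in>Z1. (\<exists>d\<in>D1 p. x - d \<in> J1) \<longrightarrow> (\<exists>d\<in>D2 (\<not> p). f x - d \<in> J2)))"

text \<open>A 2n x 2n matrix is a function nat => nat => 'r vanishing outside
  indices 0..2n-1; index i is odd iff n <= i.\<close>
type_synonym 'r mat = "nat \<Rightarrow> nat \<Rightarrow> 'r"

definition ipar :: "nat \<Rightarrow> nat \<Rightarrow> bool" where
  "ipar n i = (n \<le> i)"

definition gl_car :: "nat \<Rightarrow> ('r::zero) mat set" where
  "gl_car n = {X. \<forall>i j. (2 * n \<le> i \<or> 2 * n \<le> j) \<longrightarrow> X i j = 0}"

definition mat_hom :: "'r set \<Rightarrow> 'r set \<Rightarrow> nat \<Rightarrow> bool \<Rightarrow> 'r mat set" where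
  "mat_hom R0 R1 n p = {X. \<forall>i j. hom R0 R1 (p \<noteq> (ipar n i \<noteq> ipar n j)) (X i j)}"

definition mmul :: "nat \<Rightarrow> ('r::semiring_0) mat \<Rightarrow> 'r mat \<Rightarrow> 'r mat" where
  "mmul n X Y = (\<lambda>i j. \<Sum>k<2 * n. X i k * Y k j)"

definition msc :: "('k \<Rightarrow> 'r \<Rightarrow> 'r) \<Rightarrow> 'k \<Rightarrow> 'r mat \<Rightarrow> 'r mat" where
  "msc sc r X = (\<lambda>i j. sc r (X i j))"

definition rho :: "'r::ab_group_add set \<Rightarrow> 'r set \<Rightarrow> 'r \<Rightarrow> 'r" where
  "rho R0 R1 a = proj R0 R1 False a - proj R0 R1 True a"

definition q_car :: "'r::ab_group_add set \<Rightarrow> 'r set \<Rightarrow> nat \<Rightarrow> 'r mat set" where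
  "q_car R0 R1 n = {X \<in> gl_car n. \<forall>i<n. \<forall>j<n.
       X (i + n) (j + n) = rho R0 R1 (X i j) \<and> X (i + n) j = rho R0 R1 (X i (j + n))}"

definition gl_bracket :: "'r::ring set \<Rightarrow> 'r set \<Rightarrow> nat \<Rightarrow> 'r mat \<Rightarrow> 'r mat \<Rightarrow> 'r mat" where
  "gl_bracket R0 R1 n = scomm (mat_hom R0 R1 n False) (mat_hom R0 R1 n True) (mmul n)"

definition sq_car :: "('k \<Rightarrow> 'r \<Rightarrow> 'r) \<Rightarrow> 'r::ring set \<Rightarrow> 'r set \<Rightarrow> nat \<Rightarrow> 'r mat set" where
  "sq_car sc R0 R1 n = kspan (msc sc) {gl_bracket R0 R1 n X Y | X Y p q.
       X \<in> q_car R0 R1 n \<and> Y \<in> q_car R0 R1 n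
     \<and> X \<in> mat_hom R0 R1 n p \<and> Y \<in> mat_hom R0 R1 n q}"

text \<open>H_2(L) with trivial coefficients = ker (d_2: Lambda^2 L / im d_3 -> L),
  where Lambda^2 L / im d_3 is L (x) L modulo super-antisymmetry and the
  (cyclic form of the) image of d_3, i.e. the module <L,L> for the bracket.\<close>
definition H2_cycles :: "('k::comm_ring_1 \<Rightarrow> 'r::ring \<Rightarrow> 'r) \<Rightarrow> 'r set \<Rightarrow> 'r set \<Rightarrow> nat \<Rightarrow> ('r mat \<times> 'r mat \<Rightarrow> 'k) set" where
  "H2_cycles sc R0 R1 n = cycle_set (sq_car sc R0 R1 n) (msc sc) (gl_bracket R0 R1 n)"

definition H2_rels :: "('k::comm_ring_1 \<Rightarrow> 'r::ring \<Rightarrow> 'r) \<Rightarrow> 'r set \<Rightarrow> 'r set \<Rightarrow> nat \<Rightarrow> ('r mat \<times> 'r mat \<Rightarrow> 'k) set" where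
  "H2_rels sc R0 R1 n = lam_rels (sq_car sc R0 R1 n) (msc sc)
      (sq_car sc R0 R1 n \<inter> mat_hom R0 R1 n False) (sq_car sc R0 R1 n \<inter> mat_hom R0 R1 n True)
      (gl_bracket R0 R1 n)"

definition H2_deg :: "('k::comm_ring_1 \<Rightarrow> 'r::ring \<Rightarrow> 'r) \<Rightarrow> 'r set \<Rightarrow> 'r set \<Rightarrow> nat \<Rightarrow> bool \<Rightarrow> ('r mat \<times> 'r mat \<Rightarrow> 'k) set" where
  "H2_deg sc R0 R1 n = pairs_deg (sq_car sc R0 R1 n)
      (sq_car sc R0 R1 n \<inter> mat_hom R0 R1 n False) (sq_car sc R0 R1 n \<inter> mat_hom R0 R1 n True)"

definition HC1_cycles :: "('k::comm_ring_1 \<Rightarrow> 'r::ring \<Rightarrow> 'r) \<Rightarrow> 'r set \<Rightarrow> 'r set \<Rightarrow> ('r \<times> 'r \<Rightarrow> 'k) set" where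
  "HC1_cycles sc R0 R1 = cycle_set UNIV sc (scomm R0 R1 (*))"

definition HC1_rels :: "('k::comm_ring_1 \<Rightarrow> 'r::ring \<Rightarrow> 'r) \<Rightarrow> 'r set \<Rightarrow> 'r set \<Rightarrow> ('r \<times> 'r \<Rightarrow> 'k) set" where
  "HC1_rels sc R0 R1 = lam_rels UNIV sc R0 R1 (*)"

definition HC1_deg :: "('k::comm_ring_1 \<Rightarrow> 'r::ring \<Rightarrow> 'r) \<Rightarrow> 'r set \<Rightarrow> 'r set \<Rightarrow> bool \<Rightarrow> ('r \<times> 'r \<Rightarrow> 'k) set" where
  "HC1_deg sc R0 R1 = pairs_deg UNIV R0 R1"

end

theory Submission
  imports Defs "HOL.Modules" "HOL-Library.Product_Plus"
begin

text \<open>Adjoin to $R$ an odd $\omega$ with $\omega^2 = 1$ and $\omega a = \rho(a)\omega$, giving $S$; then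
  $\mathfrak{q}_n(R)$ is $\mathfrak{gl}_n(S)$. Linear maps out of $\langle R, R\rangle$ and out of
  $\Lambda^2 L / \mathrm{im}\, d_3$, where $L = \mathfrak{sq}_n(R)$, are both cyclic pairings: bilinear
  maps that are antisymmetric and satisfy the cyclic identity for a product. A cyclic pairing on $R$
  extends to $S$ through the $\omega$-component of the product, then to matrices over $S$ through the
  trace, and, since a cyclic pairing for an associative product is one for its supercommutator, to $L$.

  Conversely a cyclic pairing $\beta$ on $L$ gives one on $S$ through the root vectors $e_{10}(s)$ and
  $e_{01}(t)$ (indices are counted from zero), and a cyclic pairing on $S$ is a coboundary plus the
  extension of a cyclic pairing on $R$, because $2$ is invertible. Subtracting from $\beta$ a coboundary
  and the trace extension of this pairing leaves a pairing that vanishes on opposite root vectors. It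
  vanishes everywhere by a weight argument: $[\omega, \omega] = 2$ puts the whole torus $e_{ii}(1)$
  into $L$.\<close>

section \<open>Free modules, their quotients, and linear extension\<close>

lemma (in module) kspan_eq_span: "kspan scale G = span G"
proof
  show "kspan scale G \<subseteq> span G"
  proof
    fix x assume "x \<in> kspan scale G"
    then show "x \<in> span G" by induction (auto intro: span_zero span_base span_add span_scale)
  qed
  show "span G \<subseteq> kspan scale G"
    by (rule span_minimal) (auto simp: subspace_def intro: kspan.intros)
qed

interpretation fsc: module "fsc :: 'k::comm_ring_1 \<Rightarrow> ('x \<Rightarrow> 'k) \<Rightarrow> _"
  by standard (auto simp: fsc_def fun_eq_iff algebra_simps)

text \<open>A quotient by a submodule that depends on parameters is not a type, but the product of all
  quotients of a free module is one, and it contains each of them as a factor.\<close>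

quotient_type (overloaded) ('x, 'k) all_quotients = "('x \<Rightarrow> 'k::comm_ring_1) set \<Rightarrow> 'x \<Rightarrow> 'k" /
  "\<lambda>f g. \<forall>J. fsc.subspace J \<longrightarrow> f J - g J \<in> J"
proof (rule equivpI)
  show "reflp (\<lambda>f g :: ('x \<Rightarrow> 'k) set \<Rightarrow> 'x \<Rightarrow> 'k. \<forall>J. fsc.subspace J \<longrightarrow> f J - g J \<in> J)"
    by (simp add: reflp_def fsc.subspace_0)
  show "symp (\<lambda>f g :: ('x \<Rightarrow> 'k) set \<Rightarrow> 'x \<Rightarrow> 'k. \<forall>J. fsc.subspace J \<longrightarrow> f J - g J \<in> J)"
    by (rule sympI) (metis fsc.subspace_neg minus_diff_eq)
  show "transp (\<lambda>f g :: ('x \<Rightarrow> 'k) set \<Rightarrow> 'x \<Rightarrow> 'k. \<forall>J. fsc.subspace J \<longrightarrow> f J - g J \<in> J)"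
    by (rule transpI) (metis (no_types, lifting) fsc.subspace_add diff_add_cancel add_diff_eq)
qed

instantiation all_quotients :: (type, comm_ring_1) ab_group_add
begin

lift_definition zero_all_quotients :: "('a, 'b) all_quotients" is 0 .

lift_definition plus_all_quotients ::
  "('a, 'b) all_quotients \<Rightarrow> ('a, 'b) all_quotients \<Rightarrow> ('a, 'b) all_quotients" is "(+)"
proof -
  fix f f' g g' :: "('a \<Rightarrow> 'b) set \<Rightarrow> 'a \<Rightarrow> 'b" and J :: "('a \<Rightarrow> 'b) set"
  assume "\<And>J. fsc.subspace J \<Longrightarrow> f J - f' J \<in> J" "\<And>J. fsc.subspace J \<Longrightarrow> g J - g' J \<in> J" "fsc.subspace J"
  then have "(f J - f' J) + (g J - g' J) \<in> J" by (simp add: fsc.subspace_add)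
  then show "(f + g) J - (f' + g') J \<in> J" by (simp add: algebra_simps)
qed

lift_definition minus_all_quotients ::
  "('a, 'b) all_quotients \<Rightarrow> ('a, 'b) all_quotients \<Rightarrow> ('a, 'b) all_quotients" is "(-)"
proof -
  fix f f' g g' :: "('a \<Rightarrow> 'b) set \<Rightarrow> 'a \<Rightarrow> 'b" and J :: "('a \<Rightarrow> 'b) set"
  assume "\<And>J. fsc.subspace J \<Longrightarrow> f J - f' J \<in> J" "\<And>J. fsc.subspace J \<Longrightarrow> g J - g' J \<in> J" "fsc.subspace J"
  then have "(f J - f' J) - (g J - g' J) \<in> J" by (simp add: fsc.subspace_diff)
  then show "(f - g) J - (f' - g') J \<in> J" by (simp add: algebra_simps)
qed

lift_definition uminus_all_quotients :: "('a, 'b) all_quotients \<Rightarrow> ('a, 'b) all_quotients" is uminus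
proof -
  fix f f' :: "('a \<Rightarrow> 'b) set \<Rightarrow> 'a \<Rightarrow> 'b" and J :: "('a \<Rightarrow> 'b) set"
  assume "\<And>J. fsc.subspace J \<Longrightarrow> f J - f' J \<in> J" "fsc.subspace J"
  then have "- (f J - f' J) \<in> J" by (simp only: fsc.subspace_neg)
  then show "(- f) J - (- f') J \<in> J" by (simp add: algebra_simps)
qed

instance
  by standard (transfer; simp add: fsc.subspace_0 algebra_simps)+

end

lift_definition qscale :: "'k::comm_ring_1 \<Rightarrow> ('x, 'k) all_quotients \<Rightarrow> ('x, 'k) all_quotients"
  is "\<lambda>c f J. fsc c (f J)"
  by (metis fsc.scale_right_diff_distrib fsc.subspace_scale)

lift_definition coset :: "('x \<Rightarrow> 'k::comm_ring_1) set \<Rightarrow> ('x \<Rightarrow> 'k) \<Rightarrow> ('x, 'k) all_quotients"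
  is "\<lambda>J t K. if K = J then t else 0" .

interpretation quot: module qscale
  by standard (transfer; simp add: fsc.subspace_0 fsc.scale_right_distrib fsc.scale_left_distrib)+

lemma module_hom_coset: "module_hom fsc qscale (coset J)"
  by unfold_locales (transfer; simp add: fsc.subspace_0)+

lemma coset_eq_0_iff: "fsc.subspace J \<Longrightarrow> coset J t = 0 \<longleftrightarrow> t \<in> J"
  by transfer (auto simp: fsc.subspace_0)

lemma tns_in_pairs_mod: "a \<in> C \<Longrightarrow> b \<in> C \<Longrightarrow> tns a b \<in> pairs_mod C"
  unfolding pairs_mod_def by (rule kspan.gen) blast

lemma subspace_pairs_mod: "fsc.subspace (pairs_mod C)"
  by (simp add: pairs_mod_def fsc.kspan_eq_span)

lemma lin_ext_fsc_tns: "finite {x. t x \<noteq> 0} \<Longrightarrow> lin_ext fsc tns t = t"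
proof
  fix y assume supp: "finite {x. t x \<noteq> 0}"
  have "lin_ext fsc tns t y = (\<Sum>x\<in>{x. t x \<noteq> 0}. fsc (t x) (tns (fst x) (snd x)) y)"
    unfolding lin_ext_def by (rule sum_comp_morphism[of "\<lambda>f. f y", unfolded o_def, symmetric]) simp_all
  also have "\<dots> = (\<Sum>x\<in>{x. t x \<noteq> 0}. if y = x then t x else 0)"
    by (intro sum.cong) (auto simp: fsc_def tns_def)
  finally show "lin_ext fsc tns t y = t y" using supp by simp
qed

lemma pairs_mod_iff: "t \<in> pairs_mod C \<longleftrightarrow> finite {x. t x \<noteq> 0} \<and> {x. t x \<noteq> 0} \<subseteq> C \<times> C"
proof
  let ?F = "{t :: 'a \<times> 'a \<Rightarrow> 'b. finite {x. t x \<noteq> 0} \<and> {x. t x \<noteq> 0} \<subseteq> C \<times> C}"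
  have "fsc.subspace ?F"
  proof (rule fsc.subspaceI)
    fix s t :: "'a \<times> 'a \<Rightarrow> 'b" and c
    have "{x. (s + t) x \<noteq> 0} \<subseteq> {x. s x \<noteq> 0} \<union> {x. t x \<noteq> 0}" by auto
    then show "s \<in> ?F \<Longrightarrow> t \<in> ?F \<Longrightarrow> s + t \<in> ?F" by (blast intro: finite_subset)
    have "{x. fsc c t x \<noteq> 0} \<subseteq> {x. t x \<noteq> 0}" by (auto simp: fsc_def)
    then show "t \<in> ?F \<Longrightarrow> fsc c t \<in> ?F" by (blast intro: finite_subset)
  qed simp
  moreover have "{tns a b | a b. a \<in> C \<and> b \<in> C} \<subseteq> ?F" by (auto simp: tns_def split: if_splits)
  ultimately have "pairs_mod C \<subseteq> ?F"
    unfolding pairs_mod_def fsc.kspan_eq_span by (intro fsc.span_minimal)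
  then show "finite {x. t x \<noteq> 0} \<and> {x. t x \<noteq> 0} \<subseteq> C \<times> C" if "t \<in> pairs_mod C"
    using that by blast
next
  assume supp: "finite {x. t x \<noteq> 0} \<and> {x. t x \<noteq> 0} \<subseteq> C \<times> C"
  then have "t = (\<Sum>x\<in>{x. t x \<noteq> 0}. fsc (t x) (tns (fst x) (snd x)))"
    using lin_ext_fsc_tns[of t] by (simp add: lin_ext_def)
  also have "\<dots> \<in> pairs_mod C"
    using supp by (intro fsc.subspace_sum fsc.subspace_scale subspace_pairs_mod tns_in_pairs_mod) auto
  finally show "t \<in> pairs_mod C" .
qed

abbreviation finsupp :: "('m \<times> 'm \<Rightarrow> 'k::comm_ring_1) set" where
  "finsupp \<equiv> pairs_mod UNIV"

lemma pairs_mod_imp_finsupp: "t \<in> pairs_mod C \<Longrightarrow> t \<in> finsupp"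
  by (auto simp: pairs_mod_iff)

lemmas finsupp_intros = tns_in_pairs_mod[OF UNIV_I UNIV_I]
  fsc.subspace_0[OF subspace_pairs_mod] fsc.subspace_add[OF subspace_pairs_mod]
  fsc.subspace_diff[OF subspace_pairs_mod] fsc.subspace_scale[OF subspace_pairs_mod]
  fsc.subspace_sum[OF subspace_pairs_mod]

context module
begin

lemma lin_ext_superset:
  assumes "finite A" "{x. t x \<noteq> 0} \<subseteq> A"
  shows "lin_ext scale \<phi> t = (\<Sum>x\<in>A. scale (t x) (\<phi> (fst x) (snd x)))"
  unfolding lin_ext_def by (rule sum.mono_neutral_left) (use assms in auto)

lemma lin_ext_0: "lin_ext scale \<phi> 0 = 0"
  by (simp add: lin_ext_def)

lemma lin_ext_tns: "lin_ext scale \<phi> (tns a b) = \<phi> a b"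
  by (subst lin_ext_superset[of "{(a, b)}"]) (auto simp: tns_def)

lemma lin_ext_add:
  assumes "s \<in> finsupp" "t \<in> finsupp"
  shows "lin_ext scale \<phi> (s + t) = lin_ext scale \<phi> s + lin_ext scale \<phi> t"
proof -
  let ?A = "{x. s x \<noteq> 0} \<union> {x. t x \<noteq> 0}"
  have fin: "finite ?A" using assms by (simp add: pairs_mod_iff)
  have "lin_ext scale \<phi> v = (\<Sum>x\<in>?A. scale (v x) (\<phi> (fst x) (snd x)))" if "v \<in> {s, t, s + t}" for v
    by (rule lin_ext_superset[OF fin]) (use that in auto)
  then show ?thesis by (simp add: sum.distrib[symmetric] scale_left_distrib)
qed

lemma lin_ext_fsc:
  assumes "t \<in> finsupp"
  shows "lin_ext scale \<phi> (fsc c t) = scale c (lin_ext scale \<phi> t)"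
proof -
  have "lin_ext scale \<phi> (fsc c t) = (\<Sum>x\<in>{x. t x \<noteq> 0}. scale (fsc c t x) (\<phi> (fst x) (snd x)))"
    by (rule lin_ext_superset) (use assms in \<open>auto simp: pairs_mod_iff fsc_def\<close>)
  then show ?thesis by (simp add: lin_ext_def fsc_def scale_sum_right)
qed

lemma lin_ext_diff:
  assumes "s \<in> finsupp" "t \<in> finsupp"
  shows "lin_ext scale \<phi> (s - t) = lin_ext scale \<phi> s - lin_ext scale \<phi> t"
  using lin_ext_add[of "s - t" t \<phi>] assms by (simp add: finsupp_intros)

lemma lin_ext_sum:
  assumes "\<And>i. i \<in> A \<Longrightarrow> f i \<in> finsupp"
  shows "lin_ext scale \<phi> (\<Sum>i\<in>A. f i) = (\<Sum>i\<in>A. lin_ext scale \<phi> (f i))"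
  using assms
  by (induction A rule: infinite_finite_induct) (simp_all add: lin_ext_0 lin_ext_add finsupp_intros)

lemma lin_ext_cong:
  assumes "t \<in> pairs_mod C" "\<And>a b. a \<in> C \<Longrightarrow> b \<in> C \<Longrightarrow> \<phi> a b = \<psi> a b"
  shows "lin_ext scale \<phi> t = lin_ext scale \<psi> t"
  unfolding lin_ext_def using assms by (intro sum.cong) (auto simp: pairs_mod_iff)

lemma lin_ext_plus: "lin_ext scale (\<lambda>a b. \<phi> a b + \<psi> a b) t = lin_ext scale \<phi> t + lin_ext scale \<psi> t"
  by (simp add: lin_ext_def scale_right_distrib sum.distrib)

lemma lin_ext_in_subspace:
  assumes "subspace H" "t \<in> pairs_mod C" "\<And>a b. a \<in> C \<Longrightarrow> b \<in> C \<Longrightarrow> \<phi> a b \<in> H"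
  shows "lin_ext scale \<phi> t \<in> H"
  unfolding lin_ext_def
  using assms(2,3)
  by (intro subspace_sum[OF assms(1)] subspace_scale[OF assms(1)]) (auto simp: pairs_mod_iff)

lemma lin_ext_kspan_in_subspace:
  assumes "subspace H" "t \<in> kspan fsc G" "G \<subseteq> finsupp" "\<And>g. g \<in> G \<Longrightarrow> lin_ext scale \<phi> g \<in> H"
  shows "lin_ext scale \<phi> t \<in> H"
proof -
  have "fsc.subspace {t \<in> finsupp. lin_ext scale \<phi> t \<in> H}"
    by (rule fsc.subspaceI)
      (auto simp: lin_ext_0 lin_ext_add lin_ext_fsc finsupp_intros subspace_0[OF assms(1)]
        subspace_add[OF assms(1)] subspace_scale[OF assms(1)])
  then show ?thesis using fsc.span_minimal[of G "{t \<in> finsupp. lin_ext scale \<phi> t \<in> H}"] assms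
    by (auto simp: fsc.kspan_eq_span)
qed

lemma lin_ext_lin_ext:
  assumes "\<And>a b. \<psi> a b \<in> finsupp"
  shows "lin_ext scale \<phi> (lin_ext fsc \<psi> t) = lin_ext scale (\<lambda>a b. lin_ext scale \<phi> (\<psi> a b)) t"
  unfolding lin_ext_def[of fsc] lin_ext_def[of scale "\<lambda>a b. lin_ext scale \<phi> (\<psi> a b)"]
  by (simp add: lin_ext_sum lin_ext_fsc finsupp_intros assms)

end

lemma (in module_hom) hom_lin_ext: "f (lin_ext s1 \<phi> t) = lin_ext s2 (\<lambda>a b. f (\<phi> a b)) t"
  by (simp add: lin_ext_def sum scale)

lemma graded_iso_shiftI:
  fixes f :: "('x \<Rightarrow> 'k::comm_ring_1) \<Rightarrow> 'y \<Rightarrow> 'k" and g :: "('y \<Rightarrow> 'k) \<Rightarrow> 'x \<Rightarrow> 'k"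
  assumes "fsc.subspace Z1" "fsc.subspace J1" "fsc.subspace J2"
    and domain: "Z1 \<subseteq> F" "J1 \<subseteq> F" "\<And>p. D1 p \<subseteq> F"
    and f_add: "\<And>x y. x \<in> F \<Longrightarrow> y \<in> F \<Longrightarrow> f (x + y) = f x + f y"
    and f_diff: "\<And>x y. x \<in> F \<Longrightarrow> y \<in> F \<Longrightarrow> f (x - y) = f x - f y"
    and f_scale: "\<And>r x. x \<in> F \<Longrightarrow> f (fsc r x) = fsc r (f x)"
    and cycles: "\<And>x. x \<in> Z1 \<Longrightarrow> f x \<in> Z2" "\<And>z. z \<in> Z2 \<Longrightarrow> g z \<in> Z1"
    and rels: "\<And>x. x \<in> J1 \<Longrightarrow> f x \<in> J2" "\<And>z. z \<in> J2 \<Longrightarrow> g z \<in> J1"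
    and inverse: "\<And>x. x \<in> Z1 \<Longrightarrow> x - g (f x) \<in> J1" "\<And>z. z \<in> Z2 \<Longrightarrow> f (g z) - z \<in> J2"
    and degree: "\<And>p d. d \<in> D1 p \<Longrightarrow> f d \<in> D2 (\<not> p)"
  shows "graded_iso_shift Z1 J1 D1 Z2 J2 D2"
  unfolding graded_iso_shift_def
proof (intro exI[of _ f] conjI ballI allI impI)
  fix x y assume xy: "x \<in> Z1" "y \<in> Z1"
  then have diff: "f x - f y = f (x - y)" using domain f_diff by (simp add: subset_iff)
  show "f x - f y \<in> J2 \<longleftrightarrow> x - y \<in> J1"
  proof
    assume "f x - f y \<in> J2"
    then have "g (f (x - y)) \<in> J1" by (simp add: diff rels)
    moreover have "x - y - g (f (x - y)) \<in> J1" using xy assms(1) by (intro inverse fsc.subspace_diff)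
    ultimately have "g (f (x - y)) + (x - y - g (f (x - y))) \<in> J1"
      by (rule fsc.subspace_add[OF assms(2)])
    then show "x - y \<in> J1" by simp
  qed (simp add: diff rels)
next
  fix p x assume "x \<in> Z1" "\<exists>d\<in>D1 p. x - d \<in> J1"
  then obtain d where d: "d \<in> D1 p" "f (x - d) \<in> J2" using rels by blast
  moreover have "f (x - d) = f x - f d" using \<open>x \<in> Z1\<close> d domain by (intro f_diff) auto
  ultimately show "\<exists>d\<in>D2 (\<not> p). f x - d \<in> J2" using degree by auto
next
  fix z assume "z \<in> Z2"
  then show "\<exists>x\<in>Z1. f x - z \<in> J2" using cycles(2) inverse(2) by blast
qed (use domain cycles fsc.subspace_0[OF assms(3)] in \<open>auto simp: f_add f_scale subset_iff\<close>)

section \<open>Graded modules and associative superalgebras\<close>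

lemma ssign_simps [simp]:
  "ssign False q x = x" "ssign p False x = x" "ssign True True x = - x"
  "ssign p q 0 = 0" "ssign p q (- x) = - ssign p q x" "ssign p q (ssign p q x) = x"
  by (auto simp: ssign_def)

lemma ssign_diff: "ssign p q (x - y) = ssign p q x - ssign p q y"
  by (auto simp: ssign_def)

lemma ssign_sum: "ssign p q (\<Sum>i\<in>A. f i) = (\<Sum>i\<in>A. ssign p q (f i))"
  by (auto simp: ssign_def sum_negf)

lemma hom_Int: "hom (C \<inter> E) (C \<inter> Od) p a \<longleftrightarrow> a \<in> C \<and> hom E Od p a"
  by (auto simp: hom_def)

lemma (in module) scale_half_double: "2 * u = 1 \<Longrightarrow> scale u (x + x) = x"
  by (simp add: scale_right_distrib flip: scale_left_distrib mult_2)

lemma (in module) scale_ssign: "scale r (ssign p q x) = ssign p q (scale r x)"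
  and ssign_one_scale: "scale (ssign p q 1) x = ssign p q x"
  by (simp_all add: ssign_def)

lemma (in module_hom) hom_ssign: "f (ssign p q x) = ssign p q (f x)"
  by (simp add: ssign_def neg)

locale graded_module = module sc for sc :: "'k::comm_ring_1 \<Rightarrow> 'm::ab_group_add \<Rightarrow> 'm" +
  fixes E Od :: "'m set"
  assumes subspace_even: "subspace E" and subspace_odd: "subspace Od"
    and even_Int_odd: "E \<inter> Od = {0}"
    and decomposes: "\<exists>x\<in>E. \<exists>y\<in>Od. a = x + y"
begin

lemma subspace_hom: "subspace {a. hom E Od p a}"
  using subspace_even subspace_odd by (cases p) (simp_all add: hom_def)

lemma hom_0 [simp]: "hom E Od p 0"
  and hom_add: "hom E Od p a \<Longrightarrow> hom E Od p b \<Longrightarrow> hom E Od p (a + b)"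
  and hom_diff: "hom E Od p a \<Longrightarrow> hom E Od p b \<Longrightarrow> hom E Od p (a - b)"
  and hom_scale: "hom E Od p a \<Longrightarrow> hom E Od p (sc r a)"
  and hom_uminus: "hom E Od p a \<Longrightarrow> hom E Od p (- a)"
  using subspace_0[OF subspace_hom] subspace_add[OF subspace_hom] subspace_diff[OF subspace_hom]
    subspace_scale[OF subspace_hom] subspace_neg[OF subspace_hom] by auto

lemma hom_ssign: "hom E Od p a \<Longrightarrow> hom E Od p (ssign q r a)"
  by (simp add: ssign_def hom_uminus)

lemma hom_sum: "(\<And>i. i \<in> A \<Longrightarrow> hom E Od p (f i)) \<Longrightarrow> hom E Od p (\<Sum>i\<in>A. f i)"
  using subspace_sum[OF subspace_hom] by auto

lemma hom_both_parities: "hom E Od p a \<Longrightarrow> hom E Od (\<not> p) a \<Longrightarrow> a = 0"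
  using even_Int_odd by (auto simp: hom_def split: if_splits)

lemma proj_eqI:
  assumes "hom E Od p b" "hom E Od (\<not> p) (a - b)"
  shows "proj E Od p a = b"
  unfolding proj_def
proof (rule the_equality)
  fix c assume c: "hom E Od p c \<and> hom E Od (\<not> p) (a - c)"
  have "hom E Od p (c - b)" using assms c by (intro hom_diff) auto
  moreover have "hom E Od (\<not> p) (c - b)" using hom_diff[OF assms(2), of "a - c"] c by simp
  ultimately show "c = b" using hom_both_parities[of p "c - b"] by simp
qed (use assms in simp)

lemma hom_proj: "hom E Od p (proj E Od p a)"
  and hom_diff_proj: "hom E Od (\<not> p) (a - proj E Od p a)"
proof -
  obtain x y where "x \<in> E" "y \<in> Od" "a = x + y" using decomposes by blast
  then have part: "hom E Od p (if p then y else x)" "hom E Od (\<not> p) (a - (if p then y else x))"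
    by (simp_all add: hom_def)
  then have "proj E Od p a = (if p then y else x)" by (rule proj_eqI)
  with part show "hom E Od p (proj E Od p a)" "hom E Od (\<not> p) (a - proj E Od p a)" by simp_all
qed

lemma proj_add: "proj E Od p (a + b) = proj E Od p a + proj E Od p b"
  using hom_add[OF hom_diff_proj[of p a] hom_diff_proj[of p b]]
  by (intro proj_eqI hom_add hom_proj) (simp add: algebra_simps)

lemma proj_scale: "proj E Od p (sc r a) = sc r (proj E Od p a)"
  using hom_scale[OF hom_diff_proj[of p a], of r]
  by (intro proj_eqI hom_scale hom_proj) (simp add: scale_right_diff_distrib)

lemma proj_hom: "hom E Od p a \<Longrightarrow> proj E Od q a = (if p = q then a else 0)"
  by (cases "p = q") (auto intro!: proj_eqI)

lemma proj_even_add_odd: "proj E Od False a + proj E Od True a = a"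
  using proj_eqI[of True "a - proj E Od False a" a] hom_proj[of False a] hom_diff_proj[of False a]
  by simp

lemma hom_induct [case_names hom add]:
  assumes "\<And>p a. hom E Od p a \<Longrightarrow> P a" "\<And>a b. P a \<Longrightarrow> P b \<Longrightarrow> P (a + b)"
  shows "P a"
  using assms(2)[OF assms(1)[OF hom_proj] assms(1)[OF hom_proj], of False a True a]
  by (simp add: proj_even_add_odd)

end

locale bilinear_pairing = dom: module sc + cod: module scale
  for sc :: "'k::comm_ring_1 \<Rightarrow> 'm::ab_group_add \<Rightarrow> 'm" and scale :: "'k \<Rightarrow> 'v::ab_group_add \<Rightarrow> 'v" +
  fixes C :: "'m set" and \<phi> :: "'m \<Rightarrow> 'm \<Rightarrow> 'v"
  assumes subspace_carrier: "dom.subspace C"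
    and add_left: "a \<in> C \<Longrightarrow> b \<in> C \<Longrightarrow> c \<in> C \<Longrightarrow> \<phi> (a + b) c = \<phi> a c + \<phi> b c"
    and add_right: "a \<in> C \<Longrightarrow> b \<in> C \<Longrightarrow> c \<in> C \<Longrightarrow> \<phi> a (b + c) = \<phi> a b + \<phi> a c"
    and scale_left: "a \<in> C \<Longrightarrow> b \<in> C \<Longrightarrow> \<phi> (sc r a) b = scale r (\<phi> a b)"
    and scale_right: "a \<in> C \<Longrightarrow> b \<in> C \<Longrightarrow> \<phi> a (sc r b) = scale r (\<phi> a b)"
begin

lemmas carrier_intros = dom.subspace_0[OF subspace_carrier] dom.subspace_add[OF subspace_carrier]
  dom.subspace_diff[OF subspace_carrier] dom.subspace_neg[OF subspace_carrier]
  dom.subspace_scale[OF subspace_carrier]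

lemma zero_left: "a \<in> C \<Longrightarrow> \<phi> 0 a = 0"
  and zero_right: "a \<in> C \<Longrightarrow> \<phi> a 0 = 0"
  using scale_left[of 0 a 0] scale_right[of a 0 0] by (simp_all add: carrier_intros)

lemma uminus_left: "a \<in> C \<Longrightarrow> b \<in> C \<Longrightarrow> \<phi> (- a) b = - \<phi> a b"
  and uminus_right: "a \<in> C \<Longrightarrow> b \<in> C \<Longrightarrow> \<phi> a (- b) = - \<phi> a b"
  using scale_left[of a b "- 1"] scale_right[of a b "- 1"] by simp_all

lemma diff_left: "a \<in> C \<Longrightarrow> b \<in> C \<Longrightarrow> c \<in> C \<Longrightarrow> \<phi> (a - b) c = \<phi> a c - \<phi> b c"
  and diff_right: "a \<in> C \<Longrightarrow> b \<in> C \<Longrightarrow> c \<in> C \<Longrightarrow> \<phi> a (b - c) = \<phi> a b - \<phi> a c"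
  using add_left[of a "- b" c] add_right[of a b "- c"]
  by (simp_all add: uminus_left uminus_right carrier_intros)

lemma ssign_right: "a \<in> C \<Longrightarrow> b \<in> C \<Longrightarrow> \<phi> a (ssign p q b) = ssign p q (\<phi> a b)"
  by (simp add: ssign_def uminus_right)

lemma subspace_left_annihilator: "dom.subspace {a \<in> C. \<forall>b\<in>B. \<phi> a b = 0}" if "B \<subseteq> C"
  using that
  by (intro dom.subspaceI) (auto simp: carrier_intros zero_left add_left scale_left subset_iff)

lemma subspace_right_annihilator: "dom.subspace {b \<in> C. \<phi> a b = 0}" if "a \<in> C"
  using that by (intro dom.subspaceI) (auto simp: carrier_intros zero_right add_right scale_right)

end

locale assoc_superalgebra = graded_module sc E Od
  for sc :: "'k::comm_ring_1 \<Rightarrow> 'm::ab_group_add \<Rightarrow> 'm" and E Od +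
  fixes mul :: "'m \<Rightarrow> 'm \<Rightarrow> 'm"
  assumes mul_add_left: "mul (a + b) c = mul a c + mul b c"
    and mul_add_right: "mul a (b + c) = mul a b + mul a c"
    and mul_scale_left: "mul (sc r a) b = sc r (mul a b)"
    and mul_scale_right: "mul a (sc r b) = sc r (mul a b)"
    and hom_mul: "hom E Od p a \<Longrightarrow> hom E Od q b \<Longrightarrow> hom E Od (p \<noteq> q) (mul a b)"
    and mul_assoc: "mul (mul a b) c = mul a (mul b c)"
begin

sublocale mul: bilinear_pairing sc sc UNIV mul
  by unfold_locales (simp_all add: mul_add_left mul_add_right mul_scale_left mul_scale_right)

lemmas mul_0 [simp] = mul.zero_left[OF UNIV_I] mul.zero_right[OF UNIV_I]

abbreviation bracket :: "'m \<Rightarrow> 'm \<Rightarrow> 'm" where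
  "bracket \<equiv> scomm E Od mul"

lemma bracket_hom:
  assumes "hom E Od p a" "hom E Od q b"
  shows "bracket a b = mul a b - ssign p q (mul b a)"
  by (cases p; cases q; simp add: scomm_def UNIV_bool proj_hom[OF assms(1)] proj_hom[OF assms(2)])

lemma bracket_add_left: "bracket (a + b) c = bracket a c + bracket b c"
  and bracket_add_right: "bracket a (b + c) = bracket a b + bracket a c"
  by (simp_all add: scomm_def UNIV_bool proj_add mul_add_left mul_add_right)

lemma bracket_scale_left: "bracket (sc r a) b = sc r (bracket a b)"
  and bracket_scale_right: "bracket a (sc r b) = sc r (bracket a b)"
  by (simp_all add: scomm_def UNIV_bool proj_scale mul_scale_left mul_scale_right
      scale_right_diff_distrib scale_right_distrib scale_ssign)

sublocale bracket: bilinear_pairing sc sc UNIV bracket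
  by unfold_locales (simp_all add: bracket_add_left bracket_add_right bracket_scale_left
      bracket_scale_right)

lemma hom_bracket: "hom E Od p a \<Longrightarrow> hom E Od q b \<Longrightarrow> hom E Od (p \<noteq> q) (bracket a b)"
  using hom_mul[of p a q b] hom_mul[of q b p a]
  by (cases p; cases q) (auto simp: bracket_hom intro!: hom_diff hom_ssign hom_add)

lemma bracket_swap: "hom E Od p a \<Longrightarrow> hom E Od q b \<Longrightarrow> bracket b a = - ssign p q (bracket a b)"
  by (cases p; cases q) (simp_all add: bracket_hom)

end

section \<open>Cyclic pairings\<close>

locale graded_magma = dom: module sc for sc :: "'k::comm_ring_1 \<Rightarrow> 'm::ab_group_add \<Rightarrow> 'm" +
  fixes C E Od :: "'m set" and mul :: "'m \<Rightarrow> 'm \<Rightarrow> 'm"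
  assumes subspace_carrier: "dom.subspace C"
    and mul_mem: "a \<in> C \<Longrightarrow> b \<in> C \<Longrightarrow> hom E Od p a \<Longrightarrow> hom E Od q b \<Longrightarrow> mul a b \<in> C"
    and hom_mul: "a \<in> C \<Longrightarrow> b \<in> C \<Longrightarrow> hom E Od p a \<Longrightarrow> hom E Od q b \<Longrightarrow> hom E Od (p \<noteq> q) (mul a b)"

text \<open>The relations of \<open>lam_rels\<close>, read as equations in a module: cyclic pairings are the linear
  maps out of \<open>\<langle>C, C\<rangle>\<close>.\<close>

locale cyclic_pairing = graded_magma sc C E Od mul + bilinear_pairing sc scale C \<phi>
  for sc :: "'k::comm_ring_1 \<Rightarrow> 'm::ab_group_add \<Rightarrow> 'm" and scale :: "'k \<Rightarrow> 'v::ab_group_add \<Rightarrow> 'v"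
    and C E Od and mul and \<phi> :: "'m \<Rightarrow> 'm \<Rightarrow> 'v" +
  assumes antisym: "a \<in> C \<Longrightarrow> b \<in> C \<Longrightarrow> hom E Od p a \<Longrightarrow> hom E Od q b \<Longrightarrow> \<phi> a b + ssign p q (\<phi> b a) = 0"
    and cyclic: "a \<in> C \<Longrightarrow> b \<in> C \<Longrightarrow> c \<in> C \<Longrightarrow> hom E Od p a \<Longrightarrow> hom E Od q b \<Longrightarrow> hom E Od r c \<Longrightarrow>
      ssign p r (\<phi> (mul a b) c) + ssign q p (\<phi> (mul b c) a) + ssign r q (\<phi> (mul c a) b) = 0"
begin

lemma swap: "a \<in> C \<Longrightarrow> b \<in> C \<Longrightarrow> hom E Od p a \<Longrightarrow> hom E Od q b \<Longrightarrow> \<phi> b a = - ssign p q (\<phi> a b)"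
  using antisym[of b a q p] by (cases p; cases q) (simp_all add: eq_neg_iff_add_eq_0)

lemma pairing_mul_left:
  assumes "a \<in> C" "b \<in> C" "c \<in> C" "hom E Od p a" "hom E Od q b" "hom E Od r c"
  shows "\<phi> (mul a b) c = \<phi> a (mul b c) + ssign p (q \<noteq> r) (\<phi> b (mul c a))"
  using cyclic[OF assms]
    swap[OF assms(1) mul_mem[OF assms(2,3,5,6)] assms(4) hom_mul[OF assms(2,3,5,6)]]
    swap[OF assms(2) mul_mem[OF assms(3,1,6,4)] assms(5) hom_mul[OF assms(3,1,6,4)]]
  by (cases p; cases q; cases r; simp add: add_eq_0_iff algebra_simps)

lemma hom_comp:
  assumes "module_hom scale scale' f"
  shows "cyclic_pairing sc scale' C E Od mul (\<lambda>a b. f (\<phi> a b))"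
proof -
  interpret f: module_hom scale scale' f by (rule assms)
  show ?thesis
  proof unfold_locales
    fix a b p q assume "a \<in> C" "b \<in> C" "hom E Od p a" "hom E Od q b"
    then show "f (\<phi> a b) + ssign p q (f (\<phi> b a)) = 0"
      using arg_cong[OF antisym, of a b p q f] by (simp add: f.add f.hom_ssign)
  next
    fix a b c p q r assume "a \<in> C" "b \<in> C" "c \<in> C" "hom E Od p a" "hom E Od q b" "hom E Od r c"
    then show "ssign p r (f (\<phi> (mul a b) c)) + ssign q p (f (\<phi> (mul b c) a))
        + ssign r q (f (\<phi> (mul c a) b)) = 0"
      using arg_cong[OF cyclic, of a b c p q r f] by (simp add: f.add f.hom_ssign)
  qed (simp_all add: subspace_carrier add_left add_right scale_left scale_right f.add f.scale)
qed

lemma diff: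
  assumes "cyclic_pairing sc scale C E Od mul \<psi>"
  shows "cyclic_pairing sc scale C E Od mul (\<lambda>a b. \<phi> a b - \<psi> a b)"
proof -
  interpret \<psi>: cyclic_pairing sc scale C E Od mul \<psi> by (rule assms)
  show ?thesis
  proof unfold_locales
    fix a b p q assume ab: "a \<in> C" "b \<in> C" "hom E Od p a" "hom E Od q b"
    have "\<phi> a b - \<psi> a b + ssign p q (\<phi> b a - \<psi> b a)
        = (\<phi> a b + ssign p q (\<phi> b a)) - (\<psi> a b + ssign p q (\<psi> b a))"
      by (simp add: ssign_diff)
    then show "\<phi> a b - \<psi> a b + ssign p q (\<phi> b a - \<psi> b a) = 0"
      by (simp add: antisym[OF ab] \<psi>.antisym[OF ab])
  next
    fix a b c p q r assume abc: "a \<in> C" "b \<in> C" "c \<in> C" "hom E Od p a" "hom E Od q b" "hom E Od r c"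
    have "ssign p r (\<phi> (mul a b) c - \<psi> (mul a b) c) + ssign q p (\<phi> (mul b c) a - \<psi> (mul b c) a)
          + ssign r q (\<phi> (mul c a) b - \<psi> (mul c a) b)
        = (ssign p r (\<phi> (mul a b) c) + ssign q p (\<phi> (mul b c) a) + ssign r q (\<phi> (mul c a) b))
          - (ssign p r (\<psi> (mul a b) c) + ssign q p (\<psi> (mul b c) a) + ssign r q (\<psi> (mul c a) b))"
      by (simp add: ssign_diff algebra_simps)
    then show "ssign p r (\<phi> (mul a b) c - \<psi> (mul a b) c) + ssign q p (\<phi> (mul b c) a - \<psi> (mul b c) a)
        + ssign r q (\<phi> (mul c a) b - \<psi> (mul c a) b) = 0"
      by (simp add: cyclic[OF abc] \<psi>.cyclic[OF abc])
  qed (simp_all add: subspace_carrier add_left add_right scale_left scale_right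
      \<psi>.add_left \<psi>.add_right \<psi>.scale_left \<psi>.scale_right algebra_simps cod.scale_right_diff_distrib)
qed

lemma restrict:
  assumes "graded_magma sc C' (C' \<inter> E) (C' \<inter> Od) mul" "C' \<subseteq> C"
  shows "cyclic_pairing sc scale C' (C' \<inter> E) (C' \<inter> Od) mul \<phi>"
proof -
  interpret C': graded_magma sc C' "C' \<inter> E" "C' \<inter> Od" mul by (rule assms)
  show ?thesis
    using assms(2) C'.subspace_carrier
    by unfold_locales
      (auto simp: hom_Int subset_iff add_left add_right scale_left scale_right intro!: antisym cyclic)
qed

end

lemma cyclic_pairingI:
  assumes "graded_magma sc C E Od mul" "bilinear_pairing sc scale C \<phi>"
    and swap: "\<And>a b p q. a \<in> C \<Longrightarrow> b \<in> C \<Longrightarrow> hom E Od p a \<Longrightarrow> hom E Od q b \<Longrightarrow> \<phi> b a = - ssign p q (\<phi> a b)"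
    and mul_left: "\<And>a b c p q r. a \<in> C \<Longrightarrow> b \<in> C \<Longrightarrow> c \<in> C \<Longrightarrow> hom E Od p a \<Longrightarrow> hom E Od q b \<Longrightarrow> hom E Od r c \<Longrightarrow>
      \<phi> (mul a b) c = \<phi> a (mul b c) + ssign p (q \<noteq> r) (\<phi> b (mul c a))"
  shows "cyclic_pairing sc scale C E Od mul \<phi>"
proof -
  interpret graded_magma sc C E Od mul by (rule assms)
  interpret bilinear_pairing sc scale C \<phi> by (rule assms)
  show ?thesis
  proof unfold_locales
    fix a b p q assume "a \<in> C" "b \<in> C" "hom E Od p a" "hom E Od q b"
    from swap[OF this] show "\<phi> a b + ssign p q (\<phi> b a) = 0" by simp
  next
    fix a b c p q r
    assume abc: "a \<in> C" "b \<in> C" "c \<in> C" "hom E Od p a" "hom E Od q b" "hom E Od r c"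
    show "ssign p r (\<phi> (mul a b) c) + ssign q p (\<phi> (mul b c) a) + ssign r q (\<phi> (mul c a) b) = 0"
      unfolding mul_left[OF abc]
        swap[OF abc(1) mul_mem[OF abc(2,3,5,6)] abc(4) hom_mul[OF abc(2,3,5,6)]]
        swap[OF abc(2) mul_mem[OF abc(3,1,6,4)] abc(5) hom_mul[OF abc(3,1,6,4)]]
      by (cases p; cases q; cases r; simp)
  qed
qed

lemma (in cyclic_pairing) lin_ext_lam_rels:
  assumes "t \<in> lam_rels C sc E Od mul"
  shows "lin_ext scale \<phi> t = 0"
proof -
  let ?G = "bilin_rels C sc \<union> cyc_rels C E Od mul"
  note lin_ext = cod.lin_ext_tns cod.lin_ext_add cod.lin_ext_diff cod.lin_ext_fsc finsupp_intros
  have "lin_ext scale \<phi> t \<in> {0}"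
  proof (rule cod.lin_ext_kspan_in_subspace[of _ _ ?G])
    show "?G \<subseteq> finsupp" by (auto simp: bilin_rels_def cyc_rels_def finsupp_intros)
    fix g assume "g \<in> ?G"
    then show "lin_ext scale \<phi> g \<in> {0}"
      unfolding bilin_rels_def cyc_rels_def
    proof (elim UnE CollectE exE conjE)
      fix a b p q assume g: "g = tns a b + fsc (ssign p q 1) (tns b a)"
        and "a \<in> C" "b \<in> C" "hom E Od p a" "hom E Od q b"
      then show ?thesis using antisym[of a b p q] by (simp add: lin_ext cod.ssign_one_scale)
    next
      fix a b c p q r
      assume g: "g = fsc (ssign p r 1) (tns (mul a b) c) + fsc (ssign q p 1) (tns (mul b c) a)
          + fsc (ssign r q 1) (tns (mul c a) b)"
        and abc: "a \<in> C" "b \<in> C" "c \<in> C" "hom E Od p a" "hom E Od q b" "hom E Od r c"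
      then show ?thesis using cyclic[OF abc] by (simp add: lin_ext cod.ssign_one_scale)
    qed (simp_all add: lin_ext add_left add_right scale_left scale_right)
  qed (use assms in \<open>simp_all add: lam_rels_def\<close>)
  then show ?thesis by simp
qed

lemma subspace_lam_rels: "fsc.subspace (lam_rels C sc E Od mul)"
  by (simp add: lam_rels_def fsc.kspan_eq_span)

lemma lam_rels_finsupp: "lam_rels C sc E Od mul \<subseteq> finsupp"
  unfolding lam_rels_def fsc.kspan_eq_span
  by (rule fsc.span_minimal) (auto simp: subspace_pairs_mod bilin_rels_def cyc_rels_def finsupp_intros)

lemma (in graded_magma) universal_cyclic_pairing:
  "cyclic_pairing sc qscale C E Od mul (\<lambda>a b. coset (lam_rels C sc E Od mul) (tns a b))"
proof -
  let ?J = "lam_rels C sc E Od mul :: ('m \<times> 'm \<Rightarrow> 'k) set"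
  interpret coset: module_hom fsc qscale "coset ?J" by (rule module_hom_coset)
  have rel: "coset ?J t = 0" if "t \<in> bilin_rels C sc \<union> cyc_rels C E Od mul" for t
    unfolding coset_eq_0_iff[OF subspace_lam_rels] unfolding lam_rels_def using that by (rule kspan.gen)
  note coset = coset.add coset.diff coset.scale coset.hom_ssign fsc.ssign_one_scale
  show ?thesis
  proof unfold_locales
    fix a b c assume "a \<in> C" "b \<in> C" "c \<in> C"
    then have "coset ?J (tns (a + b) c - tns a c - tns b c) = 0"
        "coset ?J (tns a (b + c) - tns a b - tns a c) = 0"
      by (intro rel; unfold bilin_rels_def; blast)+
    then show "coset ?J (tns (a + b) c) = coset ?J (tns a c) + coset ?J (tns b c)"
      "coset ?J (tns a (b + c)) = coset ?J (tns a b) + coset ?J (tns a c)"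
      by (simp_all add: coset algebra_simps)
  next
    fix a b r assume "a \<in> C" "b \<in> C"
    then have "coset ?J (tns (sc r a) b - fsc r (tns a b)) = 0"
        "coset ?J (tns a (sc r b) - fsc r (tns a b)) = 0"
      by (intro rel; unfold bilin_rels_def; blast)+
    then show "coset ?J (tns (sc r a) b) = qscale r (coset ?J (tns a b))"
      "coset ?J (tns a (sc r b)) = qscale r (coset ?J (tns a b))"
      by (simp_all add: coset)
  next
    fix a b p q assume "a \<in> C" "b \<in> C" "hom E Od p a" "hom E Od q b"
    then have "coset ?J (tns a b + fsc (ssign p q 1) (tns b a)) = 0"
      by (intro rel) (unfold cyc_rels_def, blast)
    then show "coset ?J (tns a b) + ssign p q (coset ?J (tns b a)) = 0" by (simp add: coset)
  next
    fix a b c p q r assume "a \<in> C" "b \<in> C" "c \<in> C" "hom E Od p a" "hom E Od q b" "hom E Od r c"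
    then have "coset ?J (fsc (ssign p r 1) (tns (mul a b) c) + fsc (ssign q p 1) (tns (mul b c) a)
        + fsc (ssign r q 1) (tns (mul c a) b)) = 0"
      by (intro rel) (unfold cyc_rels_def, blast)
    then show "ssign p r (coset ?J (tns (mul a b) c)) + ssign q p (coset ?J (tns (mul b c) a))
        + ssign r q (coset ?J (tns (mul c a) b)) = 0" by (simp add: coset)
  qed (rule subspace_carrier)
qed

context assoc_superalgebra
begin

lemma graded_magma_UNIV: "graded_magma sc UNIV E Od mul"
  by unfold_locales (rule subspace_UNIV UNIV_I hom_mul; assumption?)+

lemma bracket_cyclic_pairing: "cyclic_pairing sc sc UNIV E Od mul bracket"
proof (rule cyclic_pairingI[OF graded_magma_UNIV bracket.bilinear_pairing_axioms])
  fix a b c p q r assume hom: "hom E Od p a" "hom E Od q b" "hom E Od r c"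
  show "bracket (mul a b) c = bracket a (mul b c) + ssign p (q \<noteq> r) (bracket b (mul c a))"
    unfolding bracket_hom[OF hom_mul[OF hom(1,2)] hom(3)] bracket_hom[OF hom(1) hom_mul[OF hom(2,3)]]
      bracket_hom[OF hom(2) hom_mul[OF hom(3,1)]]
    by (cases p; cases q; cases r; simp add: mul_assoc)
qed (rule bracket_swap)

lemma pairing_unit_right:
  assumes "cyclic_pairing sc scale UNIV E Od mul \<phi>" and "hom E Od False e"
    and unit: "\<And>a. mul a e = a" "\<And>a. mul e a = a"
  shows "\<phi> a e = 0"
proof -
  interpret \<phi>: cyclic_pairing sc scale UNIV E Od mul \<phi> by (rule assms)
  show ?thesis
  proof (induction a rule: hom_induct)
    case (hom p a)
    then show ?case
      using \<phi>.pairing_mul_left[OF UNIV_I UNIV_I UNIV_I hom assms(2,2)]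
        \<phi>.swap[OF UNIV_I UNIV_I hom assms(2)]
      by (simp add: unit)
  qed (simp add: \<phi>.add_left)
qed

lemma cyclic_pairing_bracket:
  assumes "cyclic_pairing sc scale C E Od mul \<phi>"
  shows "cyclic_pairing sc scale C E Od bracket \<phi>"
proof -
  interpret \<phi>: cyclic_pairing sc scale C E Od mul \<phi> by (rule assms)
  have bracket_mem: "bracket a b \<in> C" if "a \<in> C" "b \<in> C" "hom E Od p a" "hom E Od q b" for a b p q
    using that \<phi>.mul_mem[OF that] \<phi>.mul_mem[OF that(2,1,4,3)]
    by (simp add: bracket_hom ssign_def \<phi>.carrier_intros)
  show ?thesis
  proof (rule cyclic_pairingI)
    show "graded_magma sc C E Od bracket"
      by unfold_locales (rule \<phi>.subspace_carrier bracket_mem hom_bracket; assumption)+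
    fix a b c p q r
    assume abc: "a \<in> C" "b \<in> C" "c \<in> C" and hom: "hom E Od p a" "hom E Od q b" "hom E Od r c"
    note mem = \<phi>.mul_mem[OF abc(1,2) hom(1,2)] \<phi>.mul_mem[OF abc(2,1) hom(2,1)]
      \<phi>.mul_mem[OF abc(2,3) hom(2,3)] \<phi>.mul_mem[OF abc(3,2) hom(3,2)]
      \<phi>.mul_mem[OF abc(3,1) hom(3,1)] \<phi>.mul_mem[OF abc(1,3) hom(1,3)]
    have "\<phi> (mul a b) c = \<phi> a (mul b c) + ssign p (q \<noteq> r) (\<phi> b (mul c a))"
      "\<phi> (mul b a) c = \<phi> b (mul a c) + ssign q (p \<noteq> r) (\<phi> a (mul c b))"
      using abc hom by (blast intro: \<phi>.pairing_mul_left)+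
    then show "\<phi> (bracket a b) c = \<phi> a (bracket b c) + ssign p (q \<noteq> r) (\<phi> b (bracket c a))"
      unfolding bracket_hom[OF hom(1,2)] bracket_hom[OF hom(2,3)] bracket_hom[OF hom(3,1)]
      by (cases p; cases q; cases r;
          simp add: abc mem \<phi>.add_left \<phi>.add_right \<phi>.diff_left \<phi>.diff_right \<phi>.uminus_left \<phi>.uminus_right
            \<phi>.carrier_intros)
  qed (unfold_locales, rule \<phi>.swap)
qed

end

section \<open>Adjoining an odd square root of one\<close>

locale superalg =
  fixes sc :: "'k::comm_ring_1 \<Rightarrow> 'r::ring \<Rightarrow> 'r" and e :: 'r and R0 R1 :: "'r set"
  assumes superalgebra: "superalgebra sc e R0 R1"
begin

sublocale R: assoc_superalgebra sc R0 R1 "(*)"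
proof -
  interpret module sc
    using superalgebra by unfold_locales (simp_all add: superalgebra_def)
  show "assoc_superalgebra sc R0 R1 (*)"
    using superalgebra unfolding superalgebra_def
    by unfold_locales (simp_all add: subspace_def algebra_simps, metis+)
qed

lemma e_mult [simp]: "e * a = a" "a * e = a"
  using superalgebra by (simp_all add: superalgebra_def)

abbreviation "rhom \<equiv> hom R0 R1"

lemma rhom_e [simp]: "rhom False e"
  using superalgebra by (simp add: superalgebra_def hom_def)

abbreviation "\<rho> \<equiv> rho R0 R1"

lemma rho_hom: "rhom p a \<Longrightarrow> \<rho> a = ssign p True a"
  by (cases p) (simp_all add: rho_def R.proj_hom)

lemma rho_add [simp]: "\<rho> (a + b) = \<rho> a + \<rho> b"
  and rho_sc [simp]: "\<rho> (sc r a) = sc r (\<rho> a)"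
  by (simp_all add: rho_def R.proj_add R.proj_scale R.scale_right_diff_distrib)

sublocale rho: module_hom sc sc \<rho>
  by unfold_locales simp_all

lemma rho_e [simp]: "\<rho> e = e"
  using rho_hom[of False e] by simp

lemma rho_rho [simp]: "\<rho> (\<rho> a) = a"
proof (induction a rule: R.hom_induct)
  case (hom p a)
  then show ?case by (cases p) (simp_all add: rho_hom rho.neg)
qed simp

lemma rho_mult [simp]: "\<rho> (a * b) = \<rho> a * \<rho> b"
proof (induction a rule: R.hom_induct)
  case a: (hom p a)
  show ?case
  proof (induction b rule: R.hom_induct)
    case b: (hom q b)
    show ?case using rho_hom[OF R.hom_mul[OF a b]]
      by (cases p; cases q; simp add: rho_hom[OF a] rho_hom[OF b])
  qed (simp add: algebra_simps)
qed (simp add: algebra_simps)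

lemma rhom_rho: "rhom p a \<Longrightarrow> rhom p (\<rho> a)"
  by (simp add: rho_hom R.hom_ssign)

text \<open>The pair \<open>(a, b)\<close> stands for $a + b\omega$, where $\omega$ is odd, $\omega^2 = 1$ and
  $\omega a = \rho(a)\omega$.\<close>

definition smul :: "'r \<times> 'r \<Rightarrow> 'r \<times> 'r \<Rightarrow> 'r \<times> 'r" (infixl "\<bullet>" 70) where
  "s \<bullet> t = (fst s * fst t + snd s * \<rho> (snd t), fst s * snd t + snd s * \<rho> (fst t))"

definition ssc :: "'k \<Rightarrow> 'r \<times> 'r \<Rightarrow> 'r \<times> 'r" where
  "ssc r s = (sc r (fst s), sc r (snd s))"

definition S0 :: "('r \<times> 'r) set" where "S0 = R0 \<times> R1"

definition S1 :: "('r \<times> 'r) set" where "S1 = R1 \<times> R0"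

abbreviation "shom \<equiv> hom S0 S1"

abbreviation sone :: "'r \<times> 'r" ("\<one>") where "\<one> \<equiv> (e, 0)"

abbreviation "\<omega> \<equiv> (0, e)"

lemma shom_iff: "shom p s \<longleftrightarrow> rhom p (fst s) \<and> rhom (\<not> p) (snd s)"
  by (auto simp: hom_def S0_def S1_def mem_Times_iff)

sublocale S: assoc_superalgebra ssc S0 S1 "(\<bullet>)"
proof -
  interpret module ssc
    by unfold_locales (simp_all add: ssc_def R.scale_right_distrib R.scale_left_distrib)
  have subspace: "subspace {s. shom p s}" for p
    by (rule subspaceI) (auto simp: shom_iff ssc_def R.hom_add R.hom_scale)
  show "assoc_superalgebra ssc S0 S1 (\<bullet>)"
  proof unfold_locales
    show "subspace S0" "subspace S1"
      using subspace[of False] subspace[of True] by (simp_all add: hom_def)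
    show "S0 \<inter> S1 = {0}"
      using R.even_Int_odd by (auto simp: S0_def S1_def zero_prod_def)
    show "\<exists>x\<in>S0. \<exists>y\<in>S1. s = x + y" for s
      unfolding S0_def S1_def using R.decomposes[of "fst s"] R.decomposes[of "snd s"]
      by (force simp: prod_eq_iff add.commute)
    show "shom (p \<noteq> q) (s \<bullet> t)" if "shom p s" "shom q t" for p q s t
      using that R.hom_mul[of p "fst s" q "fst t"] R.hom_mul[of p "fst s" "\<not> q" "snd t"]
        R.hom_mul[of "\<not> p" "snd s" q "\<rho> (fst t)"] R.hom_mul[of "\<not> p" "snd s" "\<not> q" "\<rho> (snd t)"]
      by (cases p; cases q) (auto simp: shom_iff smul_def rhom_rho R.hom_add)
  qed (simp_all add: smul_def ssc_def prod_eq_iff algebra_simps R.mul_scale_left R.mul_scale_right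
      R.scale_right_distrib)
qed

lemma smul_one [simp]: "\<one> \<bullet> s = s" "s \<bullet> \<one> = s"
  by (simp_all add: smul_def)

lemma shom_one [simp]: "shom False \<one>"
  by (simp add: shom_iff)

lemma shom_pair: "rhom p a \<Longrightarrow> shom p (a, 0)" "rhom p a \<Longrightarrow> shom (\<not> p) (0, a)"
  by (simp_all add: shom_iff)

lemma shom_omega [simp]: "shom True \<omega>"
  by (simp add: shom_iff)

lemma smul_pairs: "(a, 0) \<bullet> (b, 0) = (a * b, 0)" "(a, 0) \<bullet> (0, b) = (0, a * b)"
  "(0, a) \<bullet> (b, 0) = (0, a * \<rho> b)" "(0, a) \<bullet> (0, b) = (a * \<rho> b, 0)"
  by (simp_all add: smul_def)

lemma bracket_mixed: "S.bracket (a, 0) (0, b) = (0, R.bracket a b)"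
proof (induction a rule: R.hom_induct)
  case a: (hom p a)
  show ?case
  proof (induction b rule: R.hom_induct)
    case b: (hom q b)
    show ?case
      unfolding R.bracket_hom[OF a b] S.bracket_hom[OF shom_pair(1)[OF a] shom_pair(2)[OF b]] smul_pairs
        rho_hom[OF a]
      by (cases p; cases q; simp)
  next
    case (add b c)
    then show ?case using S.bracket_add_right[of "(a, 0)" "(0, b)" "(0, c)"]
      by (simp add: R.bracket_add_right)
  qed
next
  case (add a c)
  then show ?case using S.bracket_add_left[of "(a, 0)" "(c, 0)" "(0, b)"]
    by (simp add: R.bracket_add_left)
qed

text \<open>For \<open>lam\<close> the multiplication of \<open>R\<close> this is the $\omega$-component of the product of \<open>s\<close> and \<open>t\<close>.\<close>

definition odd_form :: "('r \<Rightarrow> 'r \<Rightarrow> 'v::ab_group_add) \<Rightarrow> 'r \<times> 'r \<Rightarrow> 'r \<times> 'r \<Rightarrow> 'v" where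
  "odd_form lam s t = lam (fst s) (snd t) + lam (snd s) (\<rho> (fst t))"

lemma odd_form_bracket:
  assumes "shom p s" "shom q t"
  shows "odd_form R.bracket s t = snd (S.bracket s t)"
proof -
  have hom: "rhom p (fst s)" "rhom (\<not> p) (snd s)" "rhom q (fst t)" "rhom (\<not> q) (snd t)"
    using assms by (auto simp: shom_iff)
  show ?thesis
    unfolding odd_form_def S.bracket_hom[OF assms] R.bracket_hom[OF hom(1,4)]
      R.bracket_hom[OF hom(2) rhom_rho[OF hom(3)]] smul_def
    unfolding rho_hom[OF hom(1)] rho_hom[OF hom(3)]
    by (cases p; cases q; simp)
qed

lemma cyclic_pairing_odd_form:
  assumes "cyclic_pairing sc scale UNIV R0 R1 (*) lam"
  shows "cyclic_pairing ssc scale UNIV S0 S1 (\<bullet>) (odd_form lam)"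
proof (rule cyclic_pairingI[OF S.graded_magma_UNIV])
  interpret lam: cyclic_pairing sc scale UNIV R0 R1 "(*)" lam by (rule assms)
  note simps = lam.add_left lam.add_right lam.diff_left lam.diff_right lam.uminus_left lam.uminus_right
  show "bilinear_pairing ssc scale UNIV (odd_form lam)"
    by unfold_locales (simp_all add: odd_form_def ssc_def simps lam.scale_left lam.scale_right
        lam.cod.scale_right_distrib algebra_simps)
  fix s t p q assume st: "shom p s" "shom q t"
  then have hom: "rhom p (fst s)" "rhom (\<not> p) (snd s)" "rhom q (fst t)" "rhom (\<not> q) (snd t)"
    by (auto simp: shom_iff)
  show "odd_form lam t s = - ssign p q (odd_form lam s t)"
    unfolding odd_form_def rho_hom[OF hom(1)] rho_hom[OF hom(3)]
    using lam.swap[OF UNIV_I UNIV_I hom(1,4)] lam.swap[OF UNIV_I UNIV_I hom(2,3)]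
    by (cases p; cases q; simp add: lam.uminus_right)
  fix v r assume "shom r v"
  then have hom_v: "rhom r (fst v)" "rhom (\<not> r) (snd v)" by (auto simp: shom_iff)
  note rho = rho_hom[OF hom(1)] rho_hom[OF hom(2)] rho_hom[OF hom(3)] rho_hom[OF hom(4)]
    rho_hom[OF hom_v(1)] rho_hom[OF hom_v(2)]
  note mul_left = lam.pairing_mul_left[OF UNIV_I UNIV_I UNIV_I]
  note mul_left = mul_left[OF hom(1,3) hom_v(2)] mul_left[OF hom(2,4) hom_v(2)]
    mul_left[OF hom(1,4) hom_v(1)] mul_left[OF hom(2,3) hom_v(1)]
  show "odd_form lam (s \<bullet> t) v = odd_form lam s (t \<bullet> v) + ssign p (q \<noteq> r) (odd_form lam t (v \<bullet> s))"
    unfolding odd_form_def smul_def fst_conv snd_conv rho_add rho_mult rho_rho rho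
    by (cases p; cases q; cases r; simp add: simps mul_left rho rho.neg)
qed

end

locale superalg_half = superalg sc e R0 R1
  for sc :: "'k::comm_ring_1 \<Rightarrow> 'r::ring \<Rightarrow> 'r" and e :: 'r and R0 R1 :: "'r set" +
  fixes u :: 'k
  assumes half: "2 * u = 1"

section \<open>Cyclic pairings on $S$\<close>

locale omega_pairing = superalg_half sc e R0 R1 u + \<phi>: cyclic_pairing ssc scale UNIV S0 S1 "(\<bullet>)" \<phi>
  for sc :: "'k::comm_ring_1 \<Rightarrow> 'r::ring \<Rightarrow> 'r" and e :: 'r and R0 R1 :: "'r set" and u :: 'k
    and scale :: "'k \<Rightarrow> 'v::ab_group_add \<Rightarrow> 'v" and \<phi> :: "'r \<times> 'r \<Rightarrow> 'r \<times> 'r \<Rightarrow> 'v"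
begin

lemmas pairing_mul_left = \<phi>.pairing_mul_left[OF UNIV_I UNIV_I UNIV_I]

lemmas swap = \<phi>.swap[OF UNIV_I UNIV_I]

lemma one_right: "\<phi> s \<one> = 0"
  by (rule S.pairing_unit_right[OF \<phi>.cyclic_pairing_axioms]) simp_all

lemma add_pair: "\<phi> (a + b, 0) s = \<phi> (a, 0) s + \<phi> (b, 0) s" "\<phi> (0, a + b) s = \<phi> (0, a) s + \<phi> (0, b) s"
  "\<phi> s (a + b, 0) = \<phi> s (a, 0) + \<phi> s (b, 0)" "\<phi> s (0, a + b) = \<phi> s (0, a) + \<phi> s (0, b)"
  using \<phi>.add_left[of "(a, 0)" "(b, 0)" s] \<phi>.add_left[of "(0, a)" "(0, b)" s]
    \<phi>.add_right[of s "(a, 0)" "(b, 0)"] \<phi>.add_right[of s "(0, a)" "(0, b)"] by simp_all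

lemma uminus_pair: "\<phi> (- a, 0) s = - \<phi> (a, 0) s" "\<phi> (0, - a) s = - \<phi> (0, a) s"
  "\<phi> s (- a, 0) = - \<phi> s (a, 0)" "\<phi> s (0, - a) = - \<phi> s (0, a)"
  using \<phi>.uminus_left[of "(a, 0)" s] \<phi>.uminus_left[of "(0, a)" s]
    \<phi>.uminus_right[of s "(a, 0)"] \<phi>.uminus_right[of s "(0, a)"] by simp_all

lemma scale_pair: "\<phi> (sc r a, 0) s = scale r (\<phi> (a, 0) s)" "\<phi> (0, sc r a) s = scale r (\<phi> (0, a) s)"
  "\<phi> s (sc r a, 0) = scale r (\<phi> s (a, 0))" "\<phi> s (0, sc r a) = scale r (\<phi> s (0, a))"
  using \<phi>.scale_left[of "(a, 0)" s r] \<phi>.scale_left[of "(0, a)" s r]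
    \<phi>.scale_right[of s "(a, 0)" r] \<phi>.scale_right[of s "(0, a)" r] by (simp_all add: ssc_def)

lemma half_double: "x + x = y \<Longrightarrow> x = scale u y"
  using \<phi>.cod.scale_half_double[OF half, of x] by simp

definition mixed :: "'r \<Rightarrow> 'r \<Rightarrow> 'v" where
  "mixed a b = \<phi> (a, 0) (0, b)"

lemma mixed_e: assumes "rhom p a" shows "mixed a e = 0"
proof -
  have "\<phi> (a, 0) \<omega> = \<phi> \<omega> (\<rho> a, 0)"
    using pairing_mul_left[of "\<not> p" "(0, a)" True \<omega> True \<omega>] shom_pair(2)[OF assms]
    by (simp add: smul_pairs one_right)
  also have "\<dots> = - \<phi> (a, 0) \<omega>"
    using swap[OF shom_pair(1)[OF assms] shom_omega] unfolding rho_hom[OF assms]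
    by (cases p) (simp_all add: uminus_pair)
  finally have "mixed a e + mixed a e = 0" by (simp add: mixed_def eq_neg_iff_add_eq_0)
  from half_double[OF this] show ?thesis by simp
qed

lemma mixed_mul_left:
  assumes "rhom p a" "rhom q b" "rhom r c"
  shows "mixed (a * b) c = mixed a (b * c) + ssign p (q \<noteq> r) (mixed b (c * a))"
proof -
  note hom = shom_pair(1)[OF assms(1)] shom_pair(1)[OF assms(2)] shom_pair(2)[OF assms(3)]
  show ?thesis
    using pairing_mul_left[OF hom] unfolding smul_pairs rho_hom[OF assms(1)] mixed_def
    by (cases p; cases q; cases r; simp add: uminus_pair)
qed

lemma mixed_swap:
  assumes "rhom p a" "rhom q b"
  shows "mixed b a = - ssign p q (mixed a b)"
  using mixed_mul_left[OF assms rhom_e] mixed_e[OF R.hom_mul[OF assms]]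
  by (cases p; cases q) (simp_all add: eq_neg_iff_add_eq_0 add.commute)

lemma cyclic_pairing_mixed: "cyclic_pairing sc scale UNIV R0 R1 (*) mixed"
proof (rule cyclic_pairingI[OF R.graded_magma_UNIV])
  show "bilinear_pairing sc scale UNIV mixed"
    by unfold_locales (simp_all add: mixed_def add_pair scale_pair)
qed (rule mixed_swap mixed_mul_left; assumption)+

definition primitive :: "'r \<Rightarrow> 'v" where
  "primitive a = scale u (\<phi> (0, a) \<omega>)"

sublocale primitive: module_hom sc scale primitive
  by unfold_locales (simp_all add: primitive_def add_pair scale_pair \<phi>.cod.scale_right_distrib
      mult.commute)

lemma primitive_double: "primitive a + primitive a = \<phi> (0, a) \<omega>"
  by (simp add: primitive_def \<phi>.cod.scale_half_double[OF half] flip: \<phi>.cod.scale_right_distrib)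

lemma unmixed_via_omega:
  assumes "rhom p a" "rhom q b"
  shows "\<phi> (a, 0) (b, 0) = \<phi> (0, a * b) \<omega> - ssign q True (\<phi> (0, a) (0, b))"
proof -
  have "\<phi> (0, a * b) \<omega> = \<phi> (a, 0) (b, 0) + ssign p q (\<phi> (0, b) (0, \<rho> a))"
    using pairing_mul_left[OF shom_pair(1)[OF assms(1)] shom_pair(2)[OF assms(2)] shom_omega]
    by (simp add: smul_pairs)
  moreover have "\<phi> (0, b) (0, a) = - ssign (\<not> p) (\<not> q) (\<phi> (0, a) (0, b))"
    by (rule swap[OF shom_pair(2)[OF assms(1)] shom_pair(2)[OF assms(2)]])
  ultimately show ?thesis
    unfolding rho_hom[OF assms(1)] by (cases p; cases q; simp add: uminus_pair)
qed

lemma fst_fst_eq_primitive: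
  assumes "rhom p a" "rhom q b"
  shows "\<phi> (a, 0) (b, 0) = primitive (a * b - ssign p q (b * a))"
proof -
  have "\<phi> (a, 0) (b, 0) + \<phi> (a, 0) (b, 0) = \<phi> (a, 0) (b, 0) - ssign q p (\<phi> (b, 0) (a, 0))"
    using swap[OF shom_pair(1)[OF assms(2)] shom_pair(1)[OF assms(1)]] by simp
  also have "\<dots> = \<phi> (0, a * b) \<omega> - ssign p q (\<phi> (0, b * a) \<omega>)"
    unfolding unmixed_via_omega[OF assms] unmixed_via_omega[OF assms(2,1)]
      swap[OF shom_pair(2)[OF assms(1)] shom_pair(2)[OF assms(2)]]
    by (cases p; cases q; simp)
  finally have "\<phi> (a, 0) (b, 0) = scale u (\<phi> (0, a * b) \<omega> - ssign p q (\<phi> (0, b * a) \<omega>))"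
    by (rule half_double)
  then show ?thesis
    by (simp add: primitive.diff primitive.hom_ssign)
      (simp add: primitive_def \<phi>.cod.scale_right_diff_distrib \<phi>.cod.scale_ssign)
qed

lemma snd_snd_eq_primitive:
  assumes "rhom p a" "rhom q b"
  shows "\<phi> (0, a) (0, b) = primitive (a * \<rho> b - ssign (\<not> p) (\<not> q) (b * \<rho> a))"
proof -
  have "ssign q True (\<phi> (0, a) (0, b)) = primitive (a * b) + ssign p q (primitive (b * a))"
    using unmixed_via_omega[OF assms, folded primitive_double]
    unfolding fst_fst_eq_primitive[OF assms] primitive.diff primitive.hom_ssign
    by (simp add: algebra_simps)
  then have "\<phi> (0, a) (0, b) = ssign q True (primitive (a * b) + ssign p q (primitive (b * a)))"
    by (metis ssign_simps(6))
  then show ?thesis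
    unfolding rho_hom[OF assms(1)] rho_hom[OF assms(2)]
    by (cases p; cases q; simp add: primitive.add primitive.diff primitive.neg)
qed

theorem eq_coboundary_plus_odd_form:
  assumes "shom p s" "shom q t"
  shows "\<phi> s t = primitive (fst (S.bracket s t)) + odd_form mixed s t"
proof -
  obtain a a' b b' where st: "s = (a, a')" "t = (b, b')" by (metis surj_pair)
  have hom: "rhom p a" "rhom (\<not> p) a'" "rhom q b" "rhom (\<not> q) b'"
    using assms by (auto simp: shom_iff st)
  have split: "\<phi> s t = \<phi> (a, 0) (b, 0) + \<phi> (a, 0) (0, b') + \<phi> (0, a') (b, 0) + \<phi> (0, a') (0, b')"
    using \<phi>.add_left[of "(a, 0)" "(0, a')" t] \<phi>.add_right[of "(a, 0)" "(b, 0)" "(0, b')"]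
      \<phi>.add_right[of "(0, a')" "(b, 0)" "(0, b')"] by (simp add: st)
  have snd_fst: "\<phi> (0, a') (b, 0) = mixed a' (\<rho> b)"
    using swap[OF shom_pair(1)[OF hom(3)] shom_pair(2)[OF hom(2)]] mixed_swap[OF hom(2,3)]
    unfolding rho_hom[OF hom(3)] mixed_def by (cases p; cases q; simp add: uminus_pair)
  have bracket: "fst (S.bracket s t)
      = (a * b - ssign p q (b * a)) + (a' * \<rho> b' - ssign p q (b' * \<rho> a'))"
    unfolding S.bracket_hom[OF assms] by (simp add: st smul_def ssign_def algebra_simps)
  have snd_snd: "\<phi> (0, a') (0, b') = primitive (a' * \<rho> b' - ssign p q (b' * \<rho> a'))"
    using snd_snd_eq_primitive[OF hom(2,4)] by simp
  show ?thesis
    unfolding split bracket primitive.add snd_fst snd_snd fst_fst_eq_primitive[OF hom(1,3)]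
    by (simp add: st odd_form_def mixed_def algebra_simps)
qed

end

section \<open>The queer Lie superalgebra as matrices over $S$\<close>

lemma sum_lessThan_double: "(\<Sum>k<2 * n. f k) = (\<Sum>k<n. f k + f (k + n))"
  for f :: "nat \<Rightarrow> 'a::comm_monoid_add"
  using sum.atLeastLessThan_concat[of 0 n "2 * n" f] sum.shift_bounds_nat_ivl[of f 0 n n]
  by (simp add: lessThan_atLeast0 sum.distrib mult_2)

locale supermatrices = superalg sc e R0 R1
  for sc :: "'k::comm_ring_1 \<Rightarrow> 'r::ring \<Rightarrow> 'r" and e :: 'r and R0 R1 :: "'r set" +
  fixes n :: nat
begin

abbreviation "mhom \<equiv> mat_hom R0 R1 n"

lemma hom_mhom [simp]: "hom (mhom False) (mhom True) p X \<longleftrightarrow> X \<in> mhom p"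
  by (simp add: hom_def)

lemma mmul_in_mhom:
  assumes "X \<in> mhom p" "Y \<in> mhom q"
  shows "mmul n X Y \<in> mhom (p \<noteq> q)"
proof -
  have "rhom ((p \<noteq> q) \<noteq> (ipar n i \<noteq> ipar n j)) (X i k * Y k j)" for i j k
  proof -
    have "rhom (p \<noteq> (ipar n i \<noteq> ipar n k)) (X i k)" "rhom (q \<noteq> (ipar n k \<noteq> ipar n j)) (Y k j)"
      using assms by (auto simp: mat_hom_def)
    from R.hom_mul[OF this] show ?thesis
      by (rule back_subst[of "\<lambda>b. rhom b (X i k * Y k j)"]) auto
  qed
  then show ?thesis by (auto simp: mat_hom_def mmul_def intro!: R.hom_sum)
qed

lemma mmul_assoc: "mmul n (mmul n X Y) (Z :: 'r mat) = mmul n X (mmul n Y Z)"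
proof (intro ext)
  fix i j
  have "mmul n (mmul n X Y) Z i j = (\<Sum>k<2 * n. \<Sum>l<2 * n. X i l * Y l k * Z k j)"
    by (simp add: mmul_def sum_distrib_right)
  also have "\<dots> = (\<Sum>l<2 * n. \<Sum>k<2 * n. X i l * Y l k * Z k j)" by (rule sum.swap)
  finally show "mmul n (mmul n X Y) Z i j = mmul n X (mmul n Y Z) i j"
    by (simp add: mmul_def sum_distrib_left mult.assoc)
qed

sublocale M: assoc_superalgebra "msc sc" "mhom False" "mhom True" "mmul n"
proof -
  interpret module "msc sc"
    by unfold_locales (auto simp: msc_def fun_eq_iff R.scale_right_distrib R.scale_left_distrib)
  show "assoc_superalgebra (msc sc) (mhom False) (mhom True) (mmul n)"
  proof unfold_locales
    show "subspace (mhom False)" "subspace (mhom True)"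
      by (rule subspaceI; auto simp: mat_hom_def msc_def R.hom_add R.hom_scale)+
    show "mhom False \<inter> mhom True = {0}"
    proof (intro equalityI subsetI)
      fix X assume "X \<in> mhom False \<inter> mhom True"
      then have "X i j = 0" for i j
        using R.hom_both_parities[of "ipar n i \<noteq> ipar n j" "X i j"] by (auto simp: mat_hom_def)
      then show "X \<in> {0}" by (auto simp: fun_eq_iff)
    qed (auto simp: mat_hom_def)
    show "\<exists>Y\<in>mhom False. \<exists>Z\<in>mhom True. X = Y + Z" for X :: "'r mat"
    proof -
      define Y where "Y p = (\<lambda>i j. proj R0 R1 (p \<noteq> (ipar n i \<noteq> ipar n j)) (X i j))" for p
      have "Y p \<in> mhom p" for p
        unfolding Y_def mat_hom_def using R.hom_proj by blast
      moreover have "X i j = Y False i j + Y True i j" for i j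
        using R.proj_even_add_odd[of "X i j"]
        by (cases "ipar n i = ipar n j") (simp_all add: Y_def add.commute)
      then have "X = Y False + Y True" by (intro ext) simp
      ultimately show ?thesis by blast
    qed
    show "hom (mhom False) (mhom True) (p \<noteq> q) (mmul n X Y)"
      if "hom (mhom False) (mhom True) p X" "hom (mhom False) (mhom True) q Y" for p q X Y
      using that mmul_in_mhom unfolding hom_mhom by blast
  qed (simp_all add: mmul_assoc, simp_all add: mmul_def msc_def fun_eq_iff algebra_simps sum.distrib
      R.scale_sum_right R.mul_scale_left R.mul_scale_right)
qed

lemma gl_bracket_eq: "gl_bracket R0 R1 n = M.bracket"
  by (simp add: gl_bracket_def)

subsection \<open>Entries in $S$\<close>

abbreviation "Q \<equiv> q_car R0 R1 n"

definition ent :: "'r mat \<Rightarrow> nat \<Rightarrow> nat \<Rightarrow> 'r \<times> 'r" where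
  "ent X i j = (X i j, X i (j + n))"

definition qmat :: "(nat \<Rightarrow> nat \<Rightarrow> 'r \<times> 'r) \<Rightarrow> 'r mat" where
  "qmat f = (\<lambda>i j. if i < 2 * n \<and> j < 2 * n then
      if i < n then (if j < n then fst (f i j) else snd (f i (j - n)))
      else (if j < n then \<rho> (snd (f (i - n) j)) else \<rho> (fst (f (i - n) (j - n)))) else 0)"

lemma qmat_Q [simp]: "qmat f \<in> Q"
  by (auto simp: q_car_def gl_car_def qmat_def)

lemma ent_qmat: "i < n \<Longrightarrow> j < n \<Longrightarrow> ent (qmat f) i j = f i j"
  by (auto simp: ent_def qmat_def)

lemma qmat_cong: "(\<And>i j. i < n \<Longrightarrow> j < n \<Longrightarrow> f i j = g i j) \<Longrightarrow> qmat f = qmat g"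
  by (auto simp: qmat_def fun_eq_iff)

lemma Q_lower_blocks:
  assumes "X \<in> Q" "i < n" "j < n"
  shows "X (i + n) (j + n) = \<rho> (X i j)" "X (i + n) j = \<rho> (X i (j + n))"
  using assms by (auto simp: q_car_def)

lemma qmat_ent: assumes "X \<in> Q" shows "qmat (ent X) = X"
proof (intro ext)
  fix i j
  consider (outside) "2 * n \<le> i \<or> 2 * n \<le> j" | (upper) "i < n" "j < 2 * n"
    | (lower_left) "n \<le> i" "i < 2 * n" "j < n" | (lower_right) "n \<le> i" "i < 2 * n" "n \<le> j" "j < 2 * n"
    by linarith
  then show "qmat (ent X) i j = X i j"
  proof cases
    case outside
    then show ?thesis using assms by (auto simp: qmat_def q_car_def gl_car_def)
  next
    case lower_left
    then show ?thesis using Q_lower_blocks(2)[OF assms, of "i - n" j] by (simp add: qmat_def ent_def)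
  next
    case lower_right
    then show ?thesis using Q_lower_blocks(1)[OF assms, of "i - n" "j - n"]
      by (simp add: qmat_def ent_def)
  qed (simp add: qmat_def ent_def)
qed

lemma Q_eqI:
  assumes "X \<in> Q" "Y \<in> Q" "\<And>i j. i < n \<Longrightarrow> j < n \<Longrightarrow> ent X i j = ent Y i j"
  shows "X = Y"
  using qmat_cong[of "ent X" "ent Y", OF assms(3)] by (simp add: qmat_ent assms(1,2))

lemma subspace_Q: "M.subspace Q"
  by (rule M.subspaceI) (auto simp: q_car_def gl_car_def msc_def)

lemmas Q_closed [simp] = M.subspace_0[OF subspace_Q] M.subspace_add[OF subspace_Q]
  M.subspace_diff[OF subspace_Q] M.subspace_neg[OF subspace_Q] M.subspace_scale[OF subspace_Q]

lemmas Q_sum = M.subspace_sum[OF subspace_Q]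

lemma ent_simps [simp]: "ent 0 i j = 0" "ent (X + Y) i j = ent X i j + ent Y i j"
  "ent (- X) i j = - ent X i j" "ent (X - Y) i j = ent X i j - ent Y i j"
  "ent (msc sc r X) i j = ssc r (ent X i j)" "ent (ssign p q X) i j = ssign p q (ent X i j)"
  by (auto simp: ent_def msc_def ssc_def ssign_def prod_eq_iff)

lemma ent_sum: "ent (\<Sum>k\<in>A. f k) i j = (\<Sum>k\<in>A. ent (f k) i j)"
  by (rule sum_comp_morphism[of "\<lambda>X. ent X i j", unfolded o_def, symmetric]) simp_all

lemma mmul_in_Q [simp]:
  assumes "X \<in> Q" "Y \<in> Q" shows "mmul n X Y \<in> Q"
proof -
  have "mmul n X Y \<in> gl_car n"
    using assms by (auto simp: q_car_def gl_car_def mmul_def)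
  then show ?thesis
    by (auto simp: q_car_def mmul_def sum_lessThan_double rho.sum Q_lower_blocks[OF assms(1)]
        Q_lower_blocks[OF assms(2)] add.commute intro!: sum.cong)
qed

lemma ent_mmul:
  assumes "Y \<in> Q" "j < n"
  shows "ent (mmul n X Y) i j = (\<Sum>k<n. ent X i k \<bullet> ent Y k j)"
  by (simp add: ent_def mmul_def sum_lessThan_double smul_def prod_eq_iff fst_sum snd_sum
      Q_lower_blocks[OF assms(1) _ assms(2)])

lemma shom_ent: "X \<in> mhom p \<Longrightarrow> i < n \<Longrightarrow> j < n \<Longrightarrow> shom p (ent X i j)"
  unfolding mat_hom_def shom_iff ent_def
  by (elim CollectE, frule spec2[of _ i j], drule spec2[of _ i "j + n"]) (simp add: ipar_def)

lemma qmat_in_mhom: "(\<And>i j. i < n \<Longrightarrow> j < n \<Longrightarrow> shom p (f i j)) \<Longrightarrow> qmat f \<in> mhom p"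
  by (cases p) (auto simp: mat_hom_def shom_iff qmat_def ipar_def not_le rhom_rho)

lemma graded_magma_Q: "graded_magma (msc sc) Q (mhom False) (mhom True) (mmul n)"
  by unfold_locales (rule subspace_Q mmul_in_Q M.hom_mul; assumption)+

subsection \<open>Elementary matrices\<close>

definition elem :: "nat \<Rightarrow> nat \<Rightarrow> 'r \<times> 'r \<Rightarrow> 'r mat" where
  "elem i j s = qmat (\<lambda>k l. if k = i \<and> l = j then s else 0)"

lemma elem_Q [simp]: "elem i j s \<in> Q"
  by (simp add: elem_def)

lemma ent_elem: "k < n \<Longrightarrow> l < n \<Longrightarrow> ent (elem i j s) k l = (if k = i \<and> l = j then s else 0)"
  by (simp add: elem_def ent_qmat)

lemma elem_in_mhom: "shom p s \<Longrightarrow> elem i j s \<in> mhom p"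
  unfolding elem_def by (rule qmat_in_mhom) simp

sublocale elem: module_hom ssc "msc sc" "elem i j" for i j
  by unfold_locales (rule Q_eqI; simp add: ent_elem; simp add: ssc_def zero_prod_def)+

lemma sum_entries_elem:
  assumes "i < n" "j < n" "\<And>k l. k < n \<Longrightarrow> l < n \<Longrightarrow> f k l 0 = 0"
  shows "(\<Sum>k<n. \<Sum>l<n. f k l (ent (elem i j s) k l)) = f i j s"
proof -
  have "(\<Sum>k<n. \<Sum>l<n. f k l (ent (elem i j s) k l))
      = (\<Sum>k<n. \<Sum>l<n. if k = i then (if l = j then f i j s else 0) else 0)"
    using assms(3) by (intro sum.cong) (auto simp: ent_elem)
  also have "\<dots> = (\<Sum>k<n. if k = i then (\<Sum>l<n. if l = j then f i j s else 0) else 0)"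
    by (intro sum.cong) auto
  finally show ?thesis using assms(1,2) by simp
qed

lemma mmul_elem:
  assumes "i < n" "j < n" "k < n" "l < n"
  shows "mmul n (elem i j s) (elem k l t) = (if j = k then elem i l (s \<bullet> t) else 0)"
proof (rule Q_eqI)
  fix a b assume "a < n" "b < n"
  have "ent (mmul n (elem i j s) (elem k l t)) a b
      = (\<Sum>m<n. if m = j then (if a = i then s else 0) \<bullet> (if j = k \<and> b = l then t else 0) else 0)"
    unfolding ent_mmul[OF elem_Q \<open>b < n\<close>] using \<open>a < n\<close> \<open>b < n\<close>
    by (intro sum.cong) (auto simp: ent_elem)
  then show "ent (mmul n (elem i j s) (elem k l t)) a b
      = ent (if j = k then elem i l (s \<bullet> t) else 0) a b"
    using assms \<open>a < n\<close> \<open>b < n\<close> by (auto simp: ent_elem)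
qed auto

lemma bracket_elem:
  assumes "shom p s" "shom q t" "i < n" "j < n" "k < n" "l < n"
  shows "M.bracket (elem i j s) (elem k l t) = (if j = k then elem i l (s \<bullet> t) else 0)
     - ssign p q (if l = i then elem k j (t \<bullet> s) else 0)"
  using assms by (simp add: M.bracket_hom[of p _ q] elem_in_mhom mmul_elem)

lemma Q_decompose: assumes "X \<in> Q" shows "X = (\<Sum>i<n. \<Sum>j<n. elem i j (ent X i j))"
proof (rule Q_eqI)
  fix a b assume "a < n" "b < n"
  then have "ent (\<Sum>i<n. \<Sum>j<n. elem i j (ent X i j)) a b
      = (\<Sum>i<n. if i = a then (\<Sum>j<n. if j = b then ent X a b else 0) else 0)"
    unfolding ent_sum by (intro sum.cong) (auto simp: ent_elem intro!: sum.cong)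
  with \<open>a < n\<close> \<open>b < n\<close> show "ent X a b = ent (\<Sum>i<n. \<Sum>j<n. elem i j (ent X i j)) a b" by simp
qed (auto intro!: Q_sum assms)

lemma Q_induct [consumes 1, case_names zero elem add]:
  assumes "X \<in> Q" and "P 0"
    and elem: "\<And>i j p s. i < n \<Longrightarrow> j < n \<Longrightarrow> shom p s \<Longrightarrow> P (elem i j s)"
    and add: "\<And>X Y. X \<in> Q \<Longrightarrow> Y \<in> Q \<Longrightarrow> P X \<Longrightarrow> P Y \<Longrightarrow> P (X + Y)"
  shows "P X"
proof -
  have "P (elem i j s)" if "i < n" "j < n" for i j s
  proof (induction s rule: S.hom_induct)
    case (add s t)
    then show ?case unfolding elem.add by (intro assms(4)) simp_all
  qed (rule elem[OF that])
  moreover have sum: "(\<Sum>i\<in>A. f i) \<in> Q \<and> P (\<Sum>i\<in>A. f i)"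
    if "\<And>i. i \<in> A \<Longrightarrow> f i \<in> Q \<and> P (f i)" for A :: "nat set" and f
    using that by (induction A rule: infinite_finite_induct) (auto intro: add \<open>P 0\<close>)
  ultimately have "P (\<Sum>i<n. \<Sum>j<n. elem i j (ent X i j))"
    by (intro sum[THEN conjunct2] sum) simp_all
  then show ?thesis by (simp flip: Q_decompose[OF assms(1)])
qed

subsection \<open>Traces of pairings\<close>

definition trace_pairing :: "('r \<times> 'r \<Rightarrow> 'r \<times> 'r \<Rightarrow> 'v::ab_group_add) \<Rightarrow> 'r mat \<Rightarrow> 'r mat \<Rightarrow> 'v" where
  "trace_pairing \<phi> X Y = (\<Sum>i<n. \<Sum>j<n. \<phi> (ent X i j) (ent Y j i))"

lemma trace_pairing_elem:
  assumes "i < n" "j < n" "k < n" "l < n" "\<And>s. \<phi> 0 s = 0" "\<And>s. \<phi> s 0 = 0"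
  shows "trace_pairing \<phi> (elem i j s) (elem k l t) = (if j = k \<and> l = i then \<phi> s t else 0)"
  unfolding trace_pairing_def
  using sum_entries_elem[of i j "\<lambda>a b v. \<phi> v (ent (elem k l t) b a)" s] assms by (auto simp: ent_elem)

lemma trace_pairing_mmul_left:
  assumes Q: "X \<in> Q" "Y \<in> Q" "Z \<in> Q" and hom: "X \<in> mhom p" "Y \<in> mhom q" "Z \<in> mhom r"
    and \<phi>: "cyclic_pairing ssc scale UNIV S0 S1 (\<bullet>) \<phi>"
  shows "trace_pairing \<phi> (mmul n X Y) Z
    = trace_pairing \<phi> X (mmul n Y Z) + ssign p (q \<noteq> r) (trace_pairing \<phi> Y (mmul n Z X))"
proof -
  interpret \<phi>: cyclic_pairing ssc scale UNIV S0 S1 "(\<bullet>)" \<phi> by (rule \<phi>)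
  have \<phi>_sum: "\<phi> (\<Sum>i\<in>A. f i) s = (\<Sum>i\<in>A. \<phi> (f i) s)" "\<phi> s (\<Sum>i\<in>A. f i) = (\<Sum>i\<in>A. \<phi> s (f i))"
    for A :: "nat set" and f s
    by (induction A rule: infinite_finite_induct)
      (simp_all add: \<phi>.zero_left \<phi>.zero_right \<phi>.add_left \<phi>.add_right)
  let ?XY_Z = "\<lambda>i j k. \<phi> (ent X i k \<bullet> ent Y k j) (ent Z j i)"
  let ?X_YZ = "\<lambda>i j k. \<phi> (ent X i k) (ent Y k j \<bullet> ent Z j i)"
  let ?Y_ZX = "\<lambda>i j k. \<phi> (ent Y k j) (ent Z j i \<bullet> ent X i k)"
  have XY_Z: "trace_pairing \<phi> (mmul n X Y) Z = (\<Sum>i<n. \<Sum>j<n. \<Sum>k<n. ?XY_Z i j k)"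
    unfolding trace_pairing_def by (intro sum.cong) (auto simp: ent_mmul Q \<phi>_sum)
  have X_YZ: "trace_pairing \<phi> X (mmul n Y Z) = (\<Sum>i<n. \<Sum>j<n. \<Sum>k<n. ?X_YZ i j k)"
    unfolding trace_pairing_def by (subst (2) sum.swap) (auto simp: ent_mmul Q \<phi>_sum intro!: sum.cong)
  have "trace_pairing \<phi> Y (mmul n Z X) = (\<Sum>k<n. \<Sum>j<n. \<Sum>i<n. ?Y_ZX i j k)"
    unfolding trace_pairing_def by (intro sum.cong) (auto simp: ent_mmul Q \<phi>_sum)
  also have "\<dots> = (\<Sum>k<n. \<Sum>i<n. \<Sum>j<n. ?Y_ZX i j k)" by (intro sum.cong refl sum.swap)
  also have "\<dots> = (\<Sum>i<n. \<Sum>k<n. \<Sum>j<n. ?Y_ZX i j k)" by (rule sum.swap)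
  also have "\<dots> = (\<Sum>i<n. \<Sum>j<n. \<Sum>k<n. ?Y_ZX i j k)" by (intro sum.cong refl sum.swap)
  finally have Y_ZX: "trace_pairing \<phi> Y (mmul n Z X) = \<dots>" .
  have "?XY_Z i j k = ?X_YZ i j k + ssign p (q \<noteq> r) (?Y_ZX i j k)" if "i < n" "j < n" "k < n" for i j k
    by (intro \<phi>.pairing_mul_left UNIV_I shom_ent hom that)
  then have "(\<Sum>i<n. \<Sum>j<n. \<Sum>k<n. ?XY_Z i j k)
      = (\<Sum>i<n. \<Sum>j<n. \<Sum>k<n. ?X_YZ i j k + ssign p (q \<noteq> r) (?Y_ZX i j k))"
    by (intro sum.cong) auto
  then show ?thesis unfolding XY_Z X_YZ Y_ZX by (simp add: sum.distrib ssign_sum)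
qed

lemma cyclic_pairing_trace:
  assumes "cyclic_pairing ssc scale UNIV S0 S1 (\<bullet>) \<phi>"
  shows "cyclic_pairing (msc sc) scale Q (mhom False) (mhom True) (mmul n) (trace_pairing \<phi>)"
proof (rule cyclic_pairingI[OF graded_magma_Q])
  interpret \<phi>: cyclic_pairing ssc scale UNIV S0 S1 "(\<bullet>)" \<phi> by (rule assms)
  show "bilinear_pairing (msc sc) scale Q (trace_pairing \<phi>)"
    by unfold_locales (simp_all add: subspace_Q trace_pairing_def \<phi>.add_left \<phi>.add_right \<phi>.scale_left
        \<phi>.scale_right sum.distrib \<phi>.cod.scale_sum_right)
  fix X Y p q assume "hom (mhom False) (mhom True) p X" "hom (mhom False) (mhom True) q Y"
  then have hom: "X \<in> mhom p" "Y \<in> mhom q" by simp_all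
  have "trace_pairing \<phi> Y X = (\<Sum>i<n. \<Sum>j<n. - ssign p q (\<phi> (ent X j i) (ent Y i j)))"
    unfolding trace_pairing_def by (intro sum.cong refl \<phi>.swap UNIV_I shom_ent hom) auto
  also have "\<dots> = - ssign p q (\<Sum>i<n. \<Sum>j<n. \<phi> (ent X j i) (ent Y i j))"
    by (simp add: sum_negf ssign_sum)
  finally show "trace_pairing \<phi> Y X = - ssign p q (trace_pairing \<phi> X Y)"
    unfolding trace_pairing_def by (subst (asm) sum.swap)
qed (simp only: hom_mhom, rule trace_pairing_mmul_left[OF _ _ _ _ _ _ assms])

definition odd_trace :: "'r mat \<Rightarrow> 'r" where
  "odd_trace X = (\<Sum>i<n. snd (ent X i i))"

sublocale odd_trace: module_hom "msc sc" sc odd_trace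
  by unfold_locales (simp_all add: odd_trace_def sum.distrib ssc_def R.scale_sum_right)

lemma odd_trace_elem:
  assumes "i < n" "j < n"
  shows "odd_trace (elem i j s) = (if i = j then snd s else 0)"
proof -
  have "odd_trace (elem i j s) = (\<Sum>k<n. if k = i then (if i = j then snd s else 0) else 0)"
    unfolding odd_trace_def by (intro sum.cong) (auto simp: ent_elem)
  then show ?thesis using assms by simp
qed

lemma trace_pairing_bracket:
  assumes "X \<in> Q" "Y \<in> Q"
  shows "trace_pairing (odd_form R.bracket) X Y = odd_trace (M.bracket X Y)"
proof -
  interpret tr: cyclic_pairing "msc sc" sc Q "mhom False" "mhom True" "mmul n"
      "trace_pairing (odd_form R.bracket)"
    by (intro cyclic_pairing_trace cyclic_pairing_odd_form R.bracket_cyclic_pairing)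
  have form_0: "odd_form R.bracket 0 s = 0" "odd_form R.bracket s 0 = 0" for s
    using R.bracket_scale_left[of 0 0] R.bracket_scale_right[of _ 0 0] by (simp_all add: odd_form_def)
  have elem_elem: "trace_pairing (odd_form R.bracket) (elem i j s) (elem k l t)
      = odd_trace (M.bracket (elem i j s) (elem k l t))"
    if "i < n" "j < n" "k < n" "l < n" and hom: "shom p s" "shom q t" for i j k l s t p q
    using that by (simp add: trace_pairing_elem form_0 bracket_elem[OF hom] odd_form_bracket[OF hom]
        S.bracket_hom[OF hom] odd_trace.diff odd_trace.hom_ssign odd_trace_elem) (simp add: ssign_def)
  from assms show ?thesis
  proof (induction X rule: Q_induct)
    case (elem i j p s)
    from \<open>Y \<in> Q\<close> show ?case
    proof (induction Y rule: Q_induct)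
      case (elem k l q t)
      with \<open>i < n\<close> \<open>j < n\<close> \<open>shom p s\<close> show ?case by (intro elem_elem)
    qed (simp_all add: tr.zero_right tr.add_right M.bracket.zero_right M.bracket.add_right odd_trace.add
        del: zero_fun_apply plus_fun_apply)
  qed (simp_all add: tr.zero_left tr.add_left M.bracket.zero_left M.bracket.add_left odd_trace.add
      del: zero_fun_apply plus_fun_apply)
qed

subsection \<open>The derived algebra\<close>

abbreviation "L \<equiv> sq_car sc R0 R1 n"
abbreviation "L0 \<equiv> L \<inter> mhom False"
abbreviation "L1 \<equiv> L \<inter> mhom True"

lemma L_eq_span: "L = M.span {M.bracket X Y | X Y p q. X \<in> Q \<and> Y \<in> Q \<and> X \<in> mhom p \<and> Y \<in> mhom q}"
  by (simp add: sq_car_def M.kspan_eq_span gl_bracket_eq)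

lemma subspace_L: "M.subspace L"
  by (simp add: L_eq_span)

lemmas L_closed [simp] = M.subspace_0[OF subspace_L] M.subspace_add[OF subspace_L]
  M.subspace_diff[OF subspace_L] M.subspace_neg[OF subspace_L] M.subspace_scale[OF subspace_L]

lemma bracket_in_L: "X \<in> Q \<Longrightarrow> Y \<in> Q \<Longrightarrow> X \<in> mhom p \<Longrightarrow> Y \<in> mhom q \<Longrightarrow> M.bracket X Y \<in> L"
  unfolding L_eq_span by (rule M.span_base) blast

lemma L_subset_Q: "L \<subseteq> Q"
  unfolding L_eq_span by (rule M.span_minimal) (auto simp: subspace_Q M.bracket_hom ssign_def)

lemma L_bracket: "X \<in> L \<Longrightarrow> Y \<in> L \<Longrightarrow> X \<in> mhom p \<Longrightarrow> Y \<in> mhom q \<Longrightarrow> M.bracket X Y \<in> L"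
  using bracket_in_L L_subset_Q by blast

lemma graded_magma_L: "graded_magma (msc sc) L L0 L1 M.bracket"
proof unfold_locales
  fix X Y p q assume "hom L0 L1 p X" "hom L0 L1 q Y"
  then have XY: "X \<in> L" "Y \<in> L" "X \<in> mhom p" "Y \<in> mhom q" by (simp_all add: hom_Int)
  then show "M.bracket X Y \<in> L" by (rule L_bracket)
  then show "hom L0 L1 (p \<noteq> q) (M.bracket X Y)"
    using M.hom_bracket[of p X q Y] XY unfolding hom_Int hom_mhom by blast
qed (rule subspace_L)

lemma cyclic_pairing_trace_L:
  assumes "cyclic_pairing sc scale UNIV R0 R1 (*) lam"
  shows "cyclic_pairing (msc sc) scale L L0 L1 M.bracket (trace_pairing (odd_form lam))"
  by (intro cyclic_pairing.restrict[OF M.cyclic_pairing_bracket graded_magma_L L_subset_Q]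
      cyclic_pairing_trace cyclic_pairing_odd_form assms)

end

locale queer = supermatrices sc e R0 R1 n + superalg_half sc e R0 R1 u
  for sc :: "'k::comm_ring_1 \<Rightarrow> 'r::ring \<Rightarrow> 'r" and e :: 'r and R0 R1 :: "'r set" and n :: nat
    and u :: 'k +
  assumes three_le_n: "3 \<le> n"
begin

lemma index_bounds [simp]: "0 < n" "Suc 0 < n" "2 < n"
  using three_le_n by auto

lemma third_index: obtains k where "k < n" "k \<noteq> i" "k \<noteq> j"
proof -
  have "\<not> {0, 1, 2} \<subseteq> {i, j}" using card_mono[of "{i, j}" "{0, 1, 2}"] by (auto simp: card_insert_if)
  then show thesis using that[of 0] that[of 1] that[of 2] by auto
qed

lemma elem_in_L [simp]: "i < n \<Longrightarrow> j < n \<Longrightarrow> i \<noteq> j \<Longrightarrow> elem i j s \<in> L"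
proof (induction s rule: S.hom_induct)
  case (hom p s)
  obtain k where k: "k < n" "k \<noteq> i" "k \<noteq> j" by (rule third_index)
  then have "M.bracket (elem i k s) (elem k j \<one>) = elem i j s"
    using hom by (simp add: bracket_elem[of p _ False])
  then show ?case
    using bracket_in_L[of "elem i k s" "elem k j \<one>" p False] hom by (simp add: elem_in_mhom)
next
  case (add s t)
  then show ?case unfolding elem.add by (intro L_closed) simp_all
qed

lemma torus_in_L [simp]:
  assumes "i < n" shows "elem i i \<one> \<in> L"
proof -
  have "M.bracket (elem i i \<omega>) (elem i i \<omega>) = elem i i \<one> + elem i i \<one>"
    using assms by (simp add: bracket_elem[of True _ True] smul_pairs)
  then have "msc sc u (M.bracket (elem i i \<omega>) (elem i i \<omega>)) = elem i i \<one>"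
    by (simp only: M.scale_half_double[OF half])
  moreover have "M.bracket (elem i i \<omega>) (elem i i \<omega>) \<in> L"
    by (rule bracket_in_L[of _ _ True True]) (simp_all add: elem_in_mhom)
  ultimately show ?thesis using L_closed(5) by metis
qed

definition root_vectors :: "'r mat set" where
  "root_vectors = {elem i j s | i j s p. i < n \<and> j < n \<and> i \<noteq> j \<and> shom p s}"

definition coroots :: "'r mat set" where
  "coroots = {M.bracket (elem i j s) (elem j i t) | i j s t p q.
      i < n \<and> j < n \<and> i \<noteq> j \<and> shom p s \<and> shom q t}"

lemma generator_cases [consumes 1, case_names root coroot]:
  assumes "X \<in> root_vectors \<union> coroots"
  obtains i j s p where "i < n" "j < n" "i \<noteq> j" "shom p s" "X = elem i j s"
    | i j s t p q where "i < n" "j < n" "i \<noteq> j" "shom p s" "shom q t"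
        "X = M.bracket (elem i j s) (elem j i t)"
  using assms unfolding root_vectors_def coroots_def by blast

lemma generators_in_L:
  assumes "X \<in> root_vectors \<union> coroots"
  shows "X \<in> L" and "\<exists>p. X \<in> mhom p"
proof -
  from assms have "X \<in> L \<and> (\<exists>p. X \<in> mhom p)"
  proof (cases rule: generator_cases)
    case (coroot i j s t p q)
    then have "elem i j s \<in> mhom p" "elem j i t \<in> mhom q" by (simp_all add: elem_in_mhom)
    then show ?thesis
      using bracket_in_L[of "elem i j s" "elem j i t" p q]
        M.hom_bracket[of p "elem i j s" q "elem j i t"] coroot(6)
      by auto
  qed (auto intro: elem_in_mhom)
  then show "X \<in> L" "\<exists>p. X \<in> mhom p" by auto
qed

lemma bracket_elem_in_span:
  assumes ijkl: "i < n" "j < n" "k < n" "l < n" and st: "shom p s" "shom q t"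
  shows "M.bracket (elem i j s) (elem k l t) \<in> M.span (root_vectors \<union> coroots)"
proof -
  have root: "elem a b v \<in> M.span (root_vectors \<union> coroots)"
    if "a < n" "b < n" "a \<noteq> b" "shom r v" for a b r v
    using that unfolding root_vectors_def by (intro M.span_base) blast
  have coroot: "M.bracket (elem a b v) (elem b a w) \<in> M.span (root_vectors \<union> coroots)"
    if "a < n" "b < n" "a \<noteq> b" "shom r v" "shom r' w" for a b r r' v w
    using that unfolding coroots_def by (intro M.span_base) blast
  consider (diagonal) "j = k" "l = i" "i = j" | (opposite) "j = k" "l = i" "i \<noteq> j"
    | (not_opposite) "\<not> (j = k \<and> l = i)" by blast
  then show ?thesis
  proof cases
    case diagonal
    obtain m where m: "m < n" "m \<noteq> i" by (rule third_index[of i i])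
    have "M.bracket (elem i j s) (elem k l t)
        = M.bracket (elem i m s) (elem m i t) - ssign p q (M.bracket (elem i m \<one>) (elem m i (t \<bullet> s)))"
      using diagonal m ijkl
      by (simp add: bracket_elem[OF st] bracket_elem[OF shom_one S.hom_mul[OF st(2,1)]] ssign_diff)
    then show ?thesis
      using coroot[OF ijkl(1) m(1) m(2)[symmetric] st]
        coroot[OF ijkl(1) m(1) m(2)[symmetric] shom_one S.hom_mul[OF st(2,1)]]
      by (simp add: ssign_def M.span_diff M.span_neg M.span_add)
  next
    case opposite
    then show ?thesis using coroot ijkl st by blast
  next
    case not_opposite
    then show ?thesis
      using root[OF ijkl(1,4) _ S.hom_mul[OF st]] root[OF ijkl(3,2) _ S.hom_mul[OF st(2,1)]]
      unfolding bracket_elem[OF st ijkl]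
      by (auto simp: ssign_def intro!: M.span_diff M.span_neg M.span_zero)
  qed
qed

lemma L_subset_span_generators: "L \<subseteq> M.span (root_vectors \<union> coroots)"
proof -
  have "M.bracket X Y \<in> M.span (root_vectors \<union> coroots)" if "X \<in> Q" "Y \<in> Q" for X Y
    using that
  proof (induction X rule: Q_induct)
    case (elem i j p s)
    from \<open>Y \<in> Q\<close> show ?case
    proof (induction Y rule: Q_induct)
      case (elem k l q t)
      with \<open>i < n\<close> \<open>j < n\<close> \<open>shom p s\<close> show ?case by (intro bracket_elem_in_span)
    qed (simp_all only: M.bracket.zero_right[OF UNIV_I] M.bracket_add_right M.span_zero M.span_add)
  qed (simp_all only: M.bracket.zero_left[OF UNIV_I] M.bracket_add_left M.span_zero M.span_add)
  then show ?thesis unfolding L_eq_span by (intro M.span_minimal) auto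
qed

end

section \<open>Cyclic pairings on the special queer Lie superalgebra\<close>

locale lie_pairing = queer sc e R0 R1 n u
    + \<beta>: cyclic_pairing "msc sc" scale L L0 L1 M.bracket \<beta>
  for sc :: "'k::comm_ring_1 \<Rightarrow> 'r::ring \<Rightarrow> 'r" and e :: 'r and R0 R1 :: "'r set" and n :: nat and u :: 'k
    and scale :: "'k \<Rightarrow> 'v::ab_group_add \<Rightarrow> 'v" and \<beta> :: "'r mat \<Rightarrow> 'r mat \<Rightarrow> 'v"
begin

lemma swap: "X \<in> L \<Longrightarrow> Y \<in> L \<Longrightarrow> X \<in> mhom p \<Longrightarrow> Y \<in> mhom q \<Longrightarrow> \<beta> Y X = - ssign p q (\<beta> X Y)"
  by (rule \<beta>.swap) (simp_all add: hom_Int)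

lemma leibniz:
  assumes "X \<in> L" "Y \<in> L" "Z \<in> L" "X \<in> mhom p" "Y \<in> mhom q" "Z \<in> mhom r"
  shows "\<beta> X (M.bracket Y Z) = \<beta> (M.bracket X Y) Z + ssign p q (\<beta> Y (M.bracket X Z))"
proof -
  have "\<beta> (M.bracket X Y) Z = \<beta> X (M.bracket Y Z) + ssign p (q \<noteq> r) (\<beta> Y (M.bracket Z X))"
    using assms by (intro \<beta>.pairing_mul_left) (simp_all add: hom_Int)
  then show ?thesis
    using assms M.bracket_swap[of p X r Z] L_bracket[OF assms(1,3,4,6)]
    by (cases p; cases q; cases r; simp add: \<beta>.uminus_right)
qed

subsection \<open>Opposite root vectors\<close>

definition opposite :: "nat \<Rightarrow> nat \<Rightarrow> 'r \<times> 'r \<Rightarrow> 'r \<times> 'r \<Rightarrow> 'v" where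
  "opposite i j s t = \<beta> (elem i j s) (elem j i t)"

lemma bilinear_pairing_opposite:
  assumes "i < n" "j < n" "i \<noteq> j"
  shows "bilinear_pairing ssc scale UNIV (opposite i j)"
  using assms by unfold_locales (simp_all add: opposite_def elem.add elem.scale \<beta>.add_left \<beta>.add_right
      \<beta>.scale_left \<beta>.scale_right)

lemma opposite_swap:
  assumes "i < n" "j < n" "i \<noteq> j" "shom p s" "shom q t"
  shows "opposite j i t s = - ssign p q (opposite i j s t)"
  using assms unfolding opposite_def by (intro swap) (simp_all add: elem_in_mhom)

lemma opposite_mul_right:
  assumes "i < n" "j < n" "k < n" "i \<noteq> j" "k \<noteq> i" "k \<noteq> j" and hom: "shom p s" "shom q t" "shom r v"
  shows "opposite i j s (t \<bullet> v) = opposite i k (s \<bullet> t) v - ssign p (q \<noteq> r) (opposite j k t (v \<bullet> s))"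
proof -
  have brackets: "M.bracket (elem j k t) (elem k i v) = elem j i (t \<bullet> v)"
    "M.bracket (elem i j s) (elem j k t) = elem i k (s \<bullet> t)"
    "M.bracket (elem i j s) (elem k i v) = - ssign p r (elem k j (v \<bullet> s))"
    using assms(1-6)
    by (simp_all add: bracket_elem[OF hom(1,2)] bracket_elem[OF hom(1,3)] bracket_elem[OF hom(2,3)])
  have mem: "elem i j s \<in> L" "elem j k t \<in> L" "elem k i v \<in> L" "elem k j (v \<bullet> s) \<in> L"
    using assms(1-6) by simp_all
  show ?thesis
    using leibniz[OF mem(1-3) elem_in_mhom[OF hom(1)] elem_in_mhom[OF hom(2)] elem_in_mhom[OF hom(3)]]
    unfolding brackets opposite_def
    by (cases p; cases q; cases r; simp add: mem \<beta>.uminus_right)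
qed

definition root_pairing :: "'r \<times> 'r \<Rightarrow> 'r \<times> 'r \<Rightarrow> 'v" where
  "root_pairing s t = opposite 1 0 s t - opposite 1 0 (s \<bullet> t) \<one>"

lemma opposite_to_0:
  assumes "i < n" "i \<noteq> 0" "shom p s" "shom q t"
  shows "opposite i 0 s t = root_pairing s t + opposite i 0 (s \<bullet> t) \<one>"
proof (cases "i = 1")
  case False
  have "opposite i 1 \<one> (s \<bullet> t) = opposite i 0 s t - opposite 1 0 s t"
    using opposite_mul_right[of i 1 0 False \<one> p s q t] assms False by simp
  moreover have "opposite i 1 \<one> (s \<bullet> t) = opposite i 0 (s \<bullet> t) \<one> - opposite 1 0 (s \<bullet> t) \<one>"
    using opposite_mul_right[of i 1 0 False \<one> "p \<noteq> q" "s \<bullet> t" False \<one>] S.hom_mul[OF assms(3,4)]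
      assms False by simp
  ultimately have "opposite i 0 s t - opposite 1 0 s t
      = opposite i 0 (s \<bullet> t) \<one> - opposite 1 0 (s \<bullet> t) \<one>"
    by simp
  then show ?thesis by (simp add: root_pairing_def algebra_simps)
qed (simp add: root_pairing_def)

lemma opposite_via_0:
  assumes "i < n" "j < n" "i \<noteq> j" "i \<noteq> 0" "j \<noteq> 0" "shom p s" "shom q t"
  shows "opposite i j s t = opposite i 0 (s \<bullet> t) \<one> - ssign p q (opposite j 0 t s)"
  using opposite_mul_right[of i j 0 p s q t False \<one>] assms by simp

text \<open>Compare the two ways of moving the pairing of opposite root vectors for the indices 1, 2
  to the index 0.\<close>

lemma root_pairing_mul_right:
  assumes "shom p s" "shom q t" "shom r v"
  shows "root_pairing t (v \<bullet> s) = root_pairing (t \<bullet> v) s + ssign p (q \<noteq> r) (root_pairing (s \<bullet> t) v)"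
proof -
  note mul = S.hom_mul[OF assms(1,2)] S.hom_mul[OF assms(2,3)] S.hom_mul[OF assms(3,1)]
  have "opposite 1 2 s (t \<bullet> v) = opposite 1 0 (s \<bullet> t) v - ssign p (q \<noteq> r) (opposite 2 0 t (v \<bullet> s))"
    using opposite_mul_right[of 1 2 0 p s q t r v] assms by simp
  moreover have "opposite 1 2 s (t \<bullet> v)
      = opposite 1 0 (s \<bullet> (t \<bullet> v)) \<one> - ssign p (q \<noteq> r) (opposite 2 0 (t \<bullet> v) s)"
    by (rule opposite_via_0) (use assms mul in auto)
  ultimately have "opposite 1 0 (s \<bullet> t) v - ssign p (q \<noteq> r) (opposite 2 0 t (v \<bullet> s))
      = opposite 1 0 (s \<bullet> (t \<bullet> v)) \<one> - ssign p (q \<noteq> r) (opposite 2 0 (t \<bullet> v) s)"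
    by simp
  then show ?thesis
    using opposite_to_0[OF _ _ mul(1) assms(3), of 1] opposite_to_0[OF _ _ assms(2) mul(3), of 2]
      opposite_to_0[OF _ _ mul(2) assms(1), of 2]
    by (cases p; cases q; cases r; simp add: S.mul_assoc algebra_simps)
qed

lemma root_pairing_one_left:
  assumes "shom p s" shows "root_pairing \<one> s = 0"
proof -
  have "opposite 1 2 s \<one> = opposite 1 0 s \<one> - opposite 2 0 \<one> s"
    using opposite_via_0[of 1 2 p s False \<one>] assms by simp
  moreover have "opposite 2 1 \<one> s = opposite 2 0 s \<one> - opposite 1 0 s \<one>"
    using opposite_via_0[of 2 1 False \<one> p s] assms by simp
  moreover have "opposite 2 1 \<one> s = - opposite 1 2 s \<one>"
    using opposite_swap[of 1 2 p s False \<one>] assms by simp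
  moreover have "opposite 2 0 \<one> s = root_pairing \<one> s + opposite 2 0 s \<one>"
    using opposite_to_0[of 2 False \<one> p s] assms by simp
  ultimately show ?thesis by (simp add: algebra_simps)
qed

lemma root_pairing_swap:
  assumes "shom p s" "shom q t" shows "root_pairing t s = - ssign p q (root_pairing s t)"
  using root_pairing_mul_right[OF assms(1) shom_one assms(2)]
    root_pairing_one_left[OF S.hom_mul[OF assms(2,1)]]
  by (simp add: eq_neg_iff_add_eq_0)

lemma cyclic_pairing_root_pairing: "cyclic_pairing ssc scale UNIV S0 S1 (\<bullet>) root_pairing"
proof (rule cyclic_pairingI[OF S.graded_magma_UNIV])
  note opp = bilinear_pairing_opposite[THEN bilinear_pairing.add_left]
    bilinear_pairing_opposite[THEN bilinear_pairing.add_right]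
    bilinear_pairing_opposite[THEN bilinear_pairing.scale_left]
    bilinear_pairing_opposite[THEN bilinear_pairing.scale_right]
  show "bilinear_pairing ssc scale UNIV root_pairing"
    by unfold_locales (simp_all add: root_pairing_def opp S.mul_add_left S.mul_add_right
        S.mul_scale_left S.mul_scale_right \<beta>.cod.scale_right_diff_distrib)
  fix s t v p q r assume "shom p s" "shom q t" "shom r v"
  then show "root_pairing (s \<bullet> t) v = root_pairing s (t \<bullet> v) + ssign p (q \<noteq> r) (root_pairing t (v \<bullet> s))"
    using root_pairing_mul_right[of p s q t r v]
      root_pairing_swap[of p s "q \<noteq> r" "t \<bullet> v"] S.hom_mul[of q t r v]
    by (cases p; cases q; cases r; simp)
qed (rule root_pairing_swap)

sublocale root: omega_pairing sc e R0 R1 u scale root_pairing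
  by (intro omega_pairing.intro cyclic_pairing_root_pairing) unfold_locales

subsection \<open>The action of the torus\<close>

lemma bracket_torus:
  assumes "shom p s" "k < n" "i < n" "j < n"
  shows "M.bracket (elem k k \<one>) (elem i j s)
    = (if k = i then elem i j s else 0) - (if k = j then elem i j s else 0)"
  using assms bracket_elem[of False \<one> p s k k i j] by auto

lemma torus_leibniz:
  assumes "k < n" "X \<in> L" "Y \<in> L" "X \<in> mhom p" "Y \<in> mhom q"
  shows "\<beta> (elem k k \<one>) (M.bracket X Y)
    = \<beta> (M.bracket (elem k k \<one>) X) Y + \<beta> X (M.bracket (elem k k \<one>) Y)"
  using leibniz[of "elem k k \<one>" X Y False p q] assms by (simp add: elem_in_mhom)

end

text \<open>If \<open>h\<close> is a torus element and \<open>X\<close>, \<open>Y\<close> are weight vectors, \<open>\<beta> h [X, Y]\<close> is \<open>\<beta> X Y\<close> times the sum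
  of the weights, so such a pairing is zero.\<close>

locale normalized_lie_pairing = lie_pairing +
  assumes torus_root_hom: "i < n \<Longrightarrow> j < n \<Longrightarrow> i \<noteq> j \<Longrightarrow> shom p s \<Longrightarrow> \<beta> (elem i i \<one>) (elem i j s) = 0"
    and opposite_0_one: "i < n \<Longrightarrow> i \<noteq> 0 \<Longrightarrow> shom p s \<Longrightarrow> \<beta> (elem i 0 s) (elem 0 i \<one>) = 0"
    and opposite_1_0: "shom p s \<Longrightarrow> shom q t \<Longrightarrow> \<beta> (elem 1 0 s) (elem 0 1 t) = 0"
begin

lemma torus_root:
  assumes "i < n" "j < n" "i \<noteq> j"
  shows "\<beta> (elem i i \<one>) (elem i j s) = 0"
proof (induction s rule: S.hom_induct)
  case (add s t)
  then show ?case using assms by (simp add: elem.add \<beta>.add_right del: plus_fun_apply)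
qed (rule torus_root_hom[OF assms])

lemma opposite_0: "i < n \<Longrightarrow> i \<noteq> 0 \<Longrightarrow> shom p s \<Longrightarrow> shom q t \<Longrightarrow> opposite i 0 s t = 0"
  using opposite_to_0[of i p s q t] opposite_0_one[OF _ _ S.hom_mul] opposite_1_0[of p s q t]
  by (simp add: root_pairing_def opposite_def)

lemma opposite_eq_0:
  assumes "i < n" "j < n" "i \<noteq> j" "shom p s" "shom q t"
  shows "\<beta> (elem i j s) (elem j i t) = 0"
proof -
  consider (column_0) "j = 0" | (row_0) "i = 0" "j \<noteq> 0" | (neither_0) "i \<noteq> 0" "j \<noteq> 0" by blast
  then have "opposite i j s t = 0"
  proof cases
    case column_0
    then show ?thesis using opposite_0 assms by blast
  next
    case row_0
    then show ?thesis using opposite_swap[of j i q t p s] opposite_0[of j q t p s] assms by simp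
  next
    case neither_0
    then show ?thesis
      using opposite_via_0[OF assms(1-3) neither_0 assms(4,5)] opposite_0[of j q t p s]
        opposite_0[of i "p \<noteq> q" "s \<bullet> t" False \<one>] S.hom_mul[OF assms(4,5)] assms by simp
  qed
  then show ?thesis by (simp add: opposite_def)
qed

lemma composable_eq_0:
  assumes "i < n" "j < n" "k < n" "i \<noteq> j" "j \<noteq> k" "i \<noteq> k" and hom: "shom p s" "shom q t"
  shows "\<beta> (elem i j s) (elem j k t) = 0"
proof -
  have "\<beta> (elem i j s) (elem j k t) = \<beta> (elem i i \<one>) (M.bracket (elem i j s) (elem j k t))"
    using assms torus_leibniz[of i "elem i j s" "elem j k t" p q]
    by (simp add: elem_in_mhom bracket_torus[OF hom(1)] bracket_torus[OF hom(2)] \<beta>.zero_right)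
  also have "\<dots> = 0"
    using assms by (simp add: bracket_elem[OF hom] torus_root)
  finally show ?thesis .
qed

lemma commuting_roots_eq_0:
  assumes ij: "i < n" "j < n" "i \<noteq> j" and kl: "k < n" "l < n" "k \<noteq> l" and "j \<noteq> k" "i \<noteq> l"
    and hom: "shom p s" "shom q t"
  shows "\<beta> (elem i j s) (elem k l t) = 0"
proof -
  have weights: "\<beta> (M.bracket (elem m m \<one>) (elem i j s)) (elem k l t)
      + \<beta> (elem i j s) (M.bracket (elem m m \<one>) (elem k l t)) = 0" if "m < n" for m
    using torus_leibniz[of m "elem i j s" "elem k l t" p q] that assms
    by (simp add: bracket_elem[OF hom] elem_in_mhom \<beta>.zero_right)
  note simps = bracket_torus[OF hom(1)] bracket_torus[OF hom(2)] \<beta>.zero_left \<beta>.zero_right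
    \<beta>.uminus_left \<beta>.uminus_right
  consider (rows_differ) "i \<noteq> k" | (columns_differ) "i = k" "j \<noteq> l" | (same_root) "i = k" "j = l"
    by blast
  then show ?thesis
  proof cases
    case rows_differ
    then show ?thesis using weights[OF ij(1)] assms by (simp add: simps)
  next
    case columns_differ
    then show ?thesis using weights[OF ij(2)] assms by (simp add: simps)
  next
    case same_root
    then have "\<beta> (elem i j s) (elem k l t) + \<beta> (elem i j s) (elem k l t) = 0"
      using weights[OF ij(1)] assms by (simp add: simps)
    from root.half_double[OF this] show ?thesis by simp
  qed
qed

lemma root_root_eq_0:
  assumes ij: "i < n" "j < n" "i \<noteq> j" and kl: "k < n" "l < n" "k \<noteq> l" and hom: "shom p s" "shom q t"
  shows "\<beta> (elem i j s) (elem k l t) = 0"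
proof -
  consider (opposite) "j = k" "i = l" | (composable) "j = k" "i \<noteq> l"
    | (composable_swapped) "j \<noteq> k" "i = l" | (commuting) "j \<noteq> k" "i \<noteq> l"
    by blast
  then show ?thesis
  proof cases
    case opposite
    then show ?thesis using opposite_eq_0[OF ij hom] by simp
  next
    case composable
    then show ?thesis using composable_eq_0[of i j l p s q t] assms by simp
  next
    case composable_swapped
    have "\<beta> (elem i j s) (elem k l t) = - ssign q p (\<beta> (elem k l t) (elem i j s))"
      by (rule swap) (use assms in \<open>simp_all add: elem_in_mhom\<close>)
    then show ?thesis using composable_eq_0[of k i j q t p s] assms composable_swapped by simp
  next
    case commuting
    then show ?thesis using commuting_roots_eq_0 assms by blast
  qed
qed

lemma root_coroot_eq_0:
  assumes ij: "i < n" "j < n" "i \<noteq> j" and kl: "k < n" "l < n" "k \<noteq> l"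
    and hom: "shom p s" "shom q t" "shom r v"
  shows "\<beta> (elem i j s) (M.bracket (elem k l t) (elem l k v)) = 0"
proof -
  let ?Z = "M.bracket (elem k l t) (elem l k v)"
  note mul = S.hom_mul[OF hom(2,3)] S.hom_mul[OF hom(3,2)]
  have Z: "?Z = elem k k (t \<bullet> v) - ssign q r (elem l l (v \<bullet> t))"
    using bracket_elem[OF hom(2,3), of k l l k] kl by simp
  have Z_mem: "?Z \<in> L" "?Z \<in> mhom (q \<noteq> r)"
    using bracket_in_L[OF elem_Q elem_Q] M.hom_bracket elem_in_mhom[OF hom(2)] elem_in_mhom[OF hom(3)]
    unfolding hom_mhom by blast+
  have root_diag: "\<exists>c. M.bracket (elem i j s) (elem m m w) = elem i j c"
    if "m < n" "shom r' w" for m r' w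
    using bracket_elem[OF hom(1) that(2), of i j m m] that ij
    by (intro exI[of _ "(if j = m then s \<bullet> w else 0) - ssign p r' (if m = i then w \<bullet> s else 0)"])
      (auto simp: elem.diff elem.neg elem.hom_ssign)
  obtain c c' where "M.bracket (elem i j s) (elem k k (t \<bullet> v)) = elem i j c"
      "M.bracket (elem i j s) (elem l l (v \<bullet> t)) = elem i j c'"
    using root_diag kl mul by metis
  then have bracket_Z: "M.bracket (elem i j s) ?Z = elem i j (c - ssign q r c')"
    unfolding Z by (simp add: M.bracket.diff_right M.bracket.ssign_right elem.diff elem.hom_ssign)
  have torus_Z: "M.bracket (elem i i \<one>) ?Z = 0"
    unfolding Z M.bracket.diff_right[OF UNIV_I UNIV_I UNIV_I] M.bracket.ssign_right[OF UNIV_I UNIV_I]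
    using ij kl by (simp add: bracket_torus[OF mul(1)] bracket_torus[OF mul(2)])
  have "\<beta> (elem i j s) ?Z = \<beta> (elem i i \<one>) (M.bracket (elem i j s) ?Z)"
    using torus_leibniz[of i "elem i j s" ?Z p "q \<noteq> r"] Z_mem ij hom
    by (simp add: elem_in_mhom torus_Z bracket_torus[OF hom(1)] \<beta>.zero_right)
  then show ?thesis by (simp add: bracket_Z torus_root[OF ij])
qed

lemma root_eq_0:
  assumes "i < n" "j < n" "i \<noteq> j" "shom p s" "Y \<in> L"
  shows "\<beta> (elem i j s) Y = 0"
proof -
  have "\<beta> (elem i j s) Y = 0" if "Y \<in> root_vectors \<union> coroots" for Y
    using that
    by (cases rule: generator_cases) (use root_root_eq_0 root_coroot_eq_0 assms(1-4) in blast)+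
  then have "root_vectors \<union> coroots \<subseteq> {Y \<in> L. \<beta> (elem i j s) Y = 0}"
    using generators_in_L(1) by blast
  then have "M.span (root_vectors \<union> coroots) \<subseteq> {Y \<in> L. \<beta> (elem i j s) Y = 0}"
    using assms by (intro M.span_minimal \<beta>.subspace_right_annihilator) simp_all
  then show ?thesis using L_subset_span_generators assms(5) by blast
qed

lemma coroot_eq_0:
  assumes "i < n" "j < n" "i \<noteq> j" "shom p s" "shom q t" "Y \<in> L" "Y \<in> mhom r"
  shows "\<beta> (M.bracket (elem i j s) (elem j i t)) Y = 0"
proof -
  have "\<beta> (M.bracket (elem i j s) (elem j i t)) Y
      = \<beta> (elem i j s) (M.bracket (elem j i t) Y)
        + ssign p (q \<noteq> r) (\<beta> (elem j i t) (M.bracket Y (elem i j s)))"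
    using assms by (intro \<beta>.pairing_mul_left) (simp_all add: hom_Int elem_in_mhom)
  moreover have "M.bracket (elem j i t) Y \<in> L" "M.bracket Y (elem i j s) \<in> L"
    using assms L_bracket[of "elem j i t" Y q r] L_bracket[of Y "elem i j s" r p]
    by (simp_all add: elem_in_mhom)
  ultimately show ?thesis using root_eq_0 assms by simp
qed

theorem vanishes:
  assumes "X \<in> L" "Y \<in> L"
  shows "\<beta> X Y = 0"
proof -
  have generators_eq_0: "\<beta> X Y = 0" if "X \<in> root_vectors \<union> coroots" "Y \<in> root_vectors \<union> coroots" for X Y
    using that(1)
  proof (cases rule: generator_cases)
    case (root i j s p)
    then show ?thesis using root_eq_0 generators_in_L(1)[OF that(2)] by blast
  next
    case (coroot i j s t p q)
    then show ?thesis using coroot_eq_0 generators_in_L[OF that(2)] by blast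
  qed
  have "L \<subseteq> {X \<in> L. \<forall>Y\<in>root_vectors \<union> coroots. \<beta> X Y = 0}"
    using generators_in_L(1) generators_eq_0
    by (intro order_trans[OF L_subset_span_generators] M.span_minimal \<beta>.subspace_left_annihilator) auto
  then have "L \<subseteq> {Y \<in> L. \<beta> X Y = 0}"
    using assms(1) generators_in_L(1)
    by (intro order_trans[OF L_subset_span_generators] M.span_minimal \<beta>.subspace_right_annihilator) auto
  then show ?thesis using assms(2) by blast
qed

end

section \<open>Splitting a cyclic pairing\<close>

context lie_pairing
begin

text \<open>The parts of \<open>lift_entry\<close> are dictated by the conditions that \<open>normalized_lie_pairing\<close> imposes on
  the pairing \<open>defect\<close> below.\<close>

definition lift_entry :: "nat \<Rightarrow> nat \<Rightarrow> 'r \<times> 'r \<Rightarrow> 'v" where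
  "lift_entry i j s = (if i = j then (if i = 0 then 0 else opposite i 0 s \<one>) + root.primitive (fst s)
    else \<beta> (elem i i \<one>) (elem i j s))"

definition lift :: "'r mat \<Rightarrow> 'v" where
  "lift X = (\<Sum>i<n. \<Sum>j<n. lift_entry i j (ent X i j))"

lemma module_hom_lift_entry:
  assumes "i < n" "j < n"
  shows "module_hom ssc scale (lift_entry i j)"
proof -
  consider (off_diagonal) "i \<noteq> j" | (corner) "i = j" "i = 0" | (diagonal) "i = j" "i \<noteq> 0" by blast
  then show ?thesis
  proof cases
    case off_diagonal
    then show ?thesis
      using assms
      by unfold_locales (simp_all add: lift_entry_def elem.add elem.scale \<beta>.add_right \<beta>.scale_right)
  next
    case corner
    then show ?thesis
      by unfold_locales (simp_all add: lift_entry_def root.primitive.add root.primitive.scale ssc_def)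
  next
    case diagonal
    then interpret opp: bilinear_pairing ssc scale UNIV "opposite i 0"
      using assms by (intro bilinear_pairing_opposite) simp_all
    from diagonal have "lift_entry i j = (\<lambda>s. opposite i 0 s \<one> + root.primitive (fst s))"
      by (simp add: lift_entry_def fun_eq_iff)
    then show ?thesis
      by unfold_locales (simp_all add: opp.add_left opp.scale_left root.primitive.add
          \<beta>.cod.scale_right_distrib, simp add: ssc_def root.primitive.scale)
  qed
qed

sublocale lift: module_hom "msc sc" scale lift
proof unfold_locales
  note hom = module_hom.add[OF module_hom_lift_entry] module_hom.scale[OF module_hom_lift_entry]
  show "lift (X + Y) = lift X + lift Y" for X Y
    by (simp add: lift_def hom sum.distrib)
  show "lift (msc sc r X) = scale r (lift X)" for r X
    by (simp add: lift_def hom \<beta>.cod.scale_sum_right)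
qed

lemma lift_elem: "i < n \<Longrightarrow> j < n \<Longrightarrow> lift (elem i j s) = lift_entry i j s"
  unfolding lift_def by (rule sum_entries_elem) (use module_hom.zero[OF module_hom_lift_entry] in auto)

definition defect :: "'r mat \<Rightarrow> 'r mat \<Rightarrow> 'v" where
  "defect X Y = \<beta> X Y - lift (M.bracket X Y) - trace_pairing (odd_form root.mixed) X Y"

lemma cyclic_pairing_defect:
  "cyclic_pairing (msc sc) scale L L0 L1 M.bracket defect"
proof -
  have "cyclic_pairing (msc sc) scale L L0 L1 M.bracket (\<lambda>X Y. lift (M.bracket X Y))"
    by (intro cyclic_pairing.hom_comp[OF _ lift.module_hom_axioms] graded_magma_L subset_UNIV
        cyclic_pairing.restrict[OF M.cyclic_pairing_bracket[OF M.bracket_cyclic_pairing]])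
  then show ?thesis
    unfolding defect_def
    by (intro cyclic_pairing.diff[OF cyclic_pairing.diff] \<beta>.cyclic_pairing_axioms
        cyclic_pairing_trace_L root.cyclic_pairing_mixed)
qed

lemma trace_mixed_elem:
  assumes "i < n" "j < n" "k < n" "l < n"
  shows "trace_pairing (odd_form root.mixed) (elem i j s) (elem k l t)
    = (if j = k \<and> l = i then odd_form root.mixed s t else 0)"
proof (rule trace_pairing_elem[OF assms])
  interpret odd: cyclic_pairing ssc scale UNIV S0 S1 "(\<bullet>)" "odd_form root.mixed"
    by (rule cyclic_pairing_odd_form[OF root.cyclic_pairing_mixed])
  show "odd_form root.mixed 0 v = 0" "odd_form root.mixed v 0 = 0" for v
    by (simp_all add: odd.zero_left odd.zero_right)
qed

lemma normalized_defect: "normalized_lie_pairing sc e R0 R1 n u scale defect"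
proof (intro normalized_lie_pairing.intro normalized_lie_pairing_axioms.intro
    lie_pairing.intro queer_axioms cyclic_pairing_defect)
  fix i j p s assume "i < n" "j < n" "i \<noteq> j" "shom p s"
  then show "defect (elem i i \<one>) (elem i j s) = 0"
    by (simp add: defect_def bracket_torus trace_mixed_elem lift_elem lift_entry_def)
next
  fix i p s assume i: "i < n" "i \<noteq> 0" and s: "shom p s"
  have "lift (M.bracket (elem i 0 s) (elem 0 i \<one>)) = \<beta> (elem i 0 s) (elem 0 i \<one>)"
    using i by (simp add: bracket_elem[OF s shom_one] lift.diff lift_elem lift_entry_def opposite_def)
  moreover have "odd_form root.mixed s \<one> = 0"
    by (rule S.pairing_unit_right[OF cyclic_pairing_odd_form[OF root.cyclic_pairing_mixed]]) simp_all
  ultimately show "defect (elem i 0 s) (elem 0 i \<one>) = 0"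
    using i by (simp add: defect_def trace_mixed_elem)
next
  fix p q s t assume hom: "shom p s" "shom q t"
  have "lift (M.bracket (elem 1 0 s) (elem 0 1 t))
      = opposite 1 0 (s \<bullet> t) \<one> + root.primitive (fst (S.bracket s t))"
    by (simp add: bracket_elem[OF hom] S.bracket_hom[OF hom] lift.diff lift.hom_ssign lift_elem
        lift_entry_def root.primitive.diff) (simp add: ssign_def root.primitive.neg)
  then show "defect (elem 1 0 s) (elem 0 1 t) = 0"
    using root.eq_coboundary_plus_odd_form[OF hom]
    by (simp add: defect_def trace_mixed_elem root_pairing_def opposite_def algebra_simps)
qed

theorem splits:
  assumes "X \<in> L" "Y \<in> L"
  shows "\<beta> X Y = lift (M.bracket X Y) + trace_pairing (odd_form root.mixed) X Y"
  using normalized_lie_pairing.vanishes[OF normalized_defect assms]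
  by (simp add: defect_def algebra_simps)

end

section \<open>The isomorphism\<close>

context supermatrices
begin

definition to_HC :: "('r mat \<times> 'r mat \<Rightarrow> 'k) \<Rightarrow> 'r \<times> 'r \<Rightarrow> 'k" where
  "to_HC = lin_ext fsc (trace_pairing (odd_form tns))"

definition mixed_tns :: "'r \<Rightarrow> 'r \<Rightarrow> 'r mat \<times> 'r mat \<Rightarrow> 'k" where
  "mixed_tns a b = tns (elem 1 0 (a, 0)) (elem 0 1 (0, b)) - tns (elem 1 0 (0, a * b)) (elem 0 1 \<one>)"

definition from_HC :: "('r \<times> 'r \<Rightarrow> 'k) \<Rightarrow> 'r mat \<times> 'r mat \<Rightarrow> 'k" where
  "from_HC = lin_ext fsc mixed_tns"

lemma trace_tns_finsupp: "trace_pairing (odd_form tns) X Y \<in> finsupp"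
  by (simp add: trace_pairing_def odd_form_def finsupp_intros)

lemma mixed_tns_finsupp: "mixed_tns a b \<in> finsupp"
  by (simp add: mixed_tns_def finsupp_intros)

lemma to_HC_finsupp: "t \<in> pairs_mod C \<Longrightarrow> to_HC t \<in> finsupp"
  unfolding to_HC_def by (rule fsc.lin_ext_in_subspace[OF subspace_pairs_mod _ trace_tns_finsupp])

lemma to_HC_add: "s \<in> finsupp \<Longrightarrow> t \<in> finsupp \<Longrightarrow> to_HC (s + t) = to_HC s + to_HC t"
  and to_HC_diff: "s \<in> finsupp \<Longrightarrow> t \<in> finsupp \<Longrightarrow> to_HC (s - t) = to_HC s - to_HC t"
  and to_HC_fsc: "t \<in> finsupp \<Longrightarrow> to_HC (fsc r t) = fsc r (to_HC t)"
  by (simp_all add: to_HC_def fsc.lin_ext_add fsc.lin_ext_diff fsc.lin_ext_fsc)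

lemma lin_ext_trace_tns:
  assumes "module scale"
  shows "lin_ext scale lam (trace_pairing (odd_form tns) X Y) = trace_pairing (odd_form lam) X Y"
proof -
  interpret module scale by (rule assms)
  show ?thesis
    by (simp add: trace_pairing_def odd_form_def lin_ext_sum lin_ext_add lin_ext_tns finsupp_intros)
qed

lemma lin_ext_to_HC:
  assumes "module scale"
  shows "lin_ext scale lam (to_HC t) = lin_ext scale (trace_pairing (odd_form lam)) t"
  unfolding to_HC_def module.lin_ext_lin_ext[OF assms trace_tns_finsupp] lin_ext_trace_tns[OF assms] ..

subsection \<open>Boundaries\<close>

abbreviation lie_boundary :: "('r mat \<times> 'r mat \<Rightarrow> 'k) \<Rightarrow> 'r mat" where
  "lie_boundary \<equiv> lin_ext (msc sc) M.bracket"

abbreviation cyclic_boundary :: "('r \<times> 'r \<Rightarrow> 'k) \<Rightarrow> 'r" where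
  "cyclic_boundary \<equiv> lin_ext sc R.bracket"

lemma H2_cycles_iff: "t \<in> H2_cycles sc R0 R1 n \<longleftrightarrow> t \<in> pairs_mod L \<and> lie_boundary t = 0"
  by (simp add: H2_cycles_def cycle_set_def gl_bracket_eq)

lemma HC1_cycles_iff: "t \<in> HC1_cycles sc R0 R1 \<longleftrightarrow> t \<in> finsupp \<and> cyclic_boundary t = 0"
  by (simp add: HC1_cycles_def cycle_set_def)

lemma cyclic_boundary_to_HC:
  assumes "t \<in> pairs_mod L"
  shows "cyclic_boundary (to_HC t) = odd_trace (lie_boundary t)"
proof -
  have "cyclic_boundary (to_HC t) = lin_ext sc (trace_pairing (odd_form R.bracket)) t"
    by (rule lin_ext_to_HC) unfold_locales
  also have "\<dots> = lin_ext sc (\<lambda>X Y. odd_trace (M.bracket X Y)) t"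
    using assms by (rule R.lin_ext_cong) (use L_subset_Q in \<open>blast intro: trace_pairing_bracket\<close>)
  finally show ?thesis by (simp add: odd_trace.hom_lin_ext)
qed

lemma bracket_opposite_elems:
  assumes "1 < n"
  shows "M.bracket (elem 1 0 s) (elem 0 1 t) - M.bracket (elem 1 0 (s \<bullet> t)) (elem 0 1 \<one>)
    = elem 0 0 (S.bracket s t)"
proof (induction s rule: S.hom_induct)
  case s: (hom p s)
  show ?case
  proof (induction t rule: S.hom_induct)
    case t: (hom q t)
    show ?case
      using assms by (simp add: bracket_elem[OF s t] bracket_elem[OF S.hom_mul[OF s t] shom_one]
          S.bracket_hom[OF s t] elem.diff elem.hom_ssign)
  next
    case (add t t')
    then show ?case
      unfolding S.bracket_add_right S.mul_add_right elem.add M.bracket_add_left M.bracket_add_right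
      by (simp only: algebra_simps)
  qed
next
  case (add s s')
  then show ?case
    unfolding S.bracket_add_left S.mul_add_left elem.add M.bracket_add_left
    by (simp only: algebra_simps)
qed

end

context queer
begin

lemma lie_boundary_from_HC: "lie_boundary (from_HC t) = elem 0 0 (0, cyclic_boundary t)"
proof -
  have "lie_boundary (mixed_tns a b) = elem 0 0 (0, R.bracket a b)" for a b
    using bracket_opposite_elems[of "(a, 0)" "(0, b)"]
    by (simp add: mixed_tns_def M.lin_ext_diff M.lin_ext_tns finsupp_intros bracket_mixed smul_pairs)
  moreover have "module_hom sc ssc (\<lambda>a. (0, a))"
    by unfold_locales (simp_all add: ssc_def)
  then have "elem 0 0 (0, cyclic_boundary t) = lin_ext (msc sc) (\<lambda>a b. elem 0 0 (0, R.bracket a b)) t"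
    by (simp add: module_hom.hom_lin_ext elem.hom_lin_ext)
  ultimately show ?thesis
    by (simp add: from_HC_def M.lin_ext_lin_ext[OF mixed_tns_finsupp])
qed

lemma from_HC_pairs_mod:
  assumes "t \<in> finsupp"
  shows "from_HC t \<in> pairs_mod L"
proof -
  have "mixed_tns a b \<in> pairs_mod L" for a b
    unfolding mixed_tns_def by (intro fsc.subspace_diff subspace_pairs_mod tns_in_pairs_mod) simp_all
  then show ?thesis
    unfolding from_HC_def by (intro fsc.lin_ext_in_subspace[OF subspace_pairs_mod assms])
qed

subsection \<open>The two maps modulo the relations\<close>

definition lie_class :: "'r mat \<Rightarrow> 'r mat \<Rightarrow> ('r mat \<times> 'r mat, 'k) all_quotients" where
  "lie_class X Y = coset (H2_rels sc R0 R1 n) (tns X Y)"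

definition cyclic_class :: "'r \<Rightarrow> 'r \<Rightarrow> ('r \<times> 'r, 'k) all_quotients" where
  "cyclic_class a b = coset (HC1_rels sc R0 R1) (tns a b)"

lemma H2_rels_eq:
  "H2_rels sc R0 R1 n = lam_rels L (msc sc) L0 L1 M.bracket"
  by (simp add: H2_rels_def gl_bracket_eq)

interpretation lie: lie_pairing sc e R0 R1 n u qscale lie_class
  unfolding lie_class_def[abs_def] H2_rels_eq
  by (intro lie_pairing.intro queer_axioms graded_magma.universal_cyclic_pairing graded_magma_L)

interpretation cyclic: cyclic_pairing sc qscale UNIV R0 R1 "(*)" cyclic_class
  unfolding cyclic_class_def[abs_def] HC1_rels_def
  by (intro graded_magma.universal_cyclic_pairing R.graded_magma_UNIV)

interpretation odd_cyclic: cyclic_pairing ssc qscale UNIV S0 S1 "(\<bullet>)" "odd_form cyclic_class"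
  by (rule cyclic_pairing_odd_form[OF cyclic.cyclic_pairing_axioms])

interpretation trace_cyclic: cyclic_pairing "msc sc" qscale L L0 L1 M.bracket
    "trace_pairing (odd_form cyclic_class)"
  by (rule cyclic_pairing_trace_L[OF cyclic.cyclic_pairing_axioms])

lemma coset_H2_rels_eq_0_iff: "coset (H2_rels sc R0 R1 n) t = 0 \<longleftrightarrow> t \<in> H2_rels sc R0 R1 n"
  and coset_HC1_rels_eq_0_iff: "coset (HC1_rels sc R0 R1) v = 0 \<longleftrightarrow> v \<in> HC1_rels sc R0 R1"
  by (simp_all add: coset_eq_0_iff H2_rels_def HC1_rels_def subspace_lam_rels)

lemma coset_H2_rels: "t \<in> finsupp \<Longrightarrow> coset (H2_rels sc R0 R1 n) t = lin_ext qscale lie_class t"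
  and coset_HC1_rels: "v \<in> finsupp \<Longrightarrow> coset (HC1_rels sc R0 R1) v = lin_ext qscale cyclic_class v"
  using module_hom.hom_lin_ext[OF module_hom_coset, of _ tns t]
    module_hom.hom_lin_ext[OF module_hom_coset, of _ tns v]
  by (simp_all add: lie_class_def[abs_def] cyclic_class_def[abs_def] lin_ext_fsc_tns pairs_mod_iff)

lemma coset_to_HC:
  "t \<in> pairs_mod C \<Longrightarrow>
    coset (HC1_rels sc R0 R1) (to_HC t) = lin_ext qscale (trace_pairing (odd_form cyclic_class)) t"
  by (simp add: coset_HC1_rels to_HC_finsupp lin_ext_to_HC quot.module_axioms)

lemma coset_mixed_tns: "coset (H2_rels sc R0 R1 n) (mixed_tns a b) = lie.root.mixed a b"
  by (simp add: mixed_tns_def module_hom.diff[OF module_hom_coset] lie.root.mixed_def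
      lie.root_pairing_def lie.opposite_def lie_class_def smul_pairs)

lemma coset_from_HC: "coset (H2_rels sc R0 R1 n) (from_HC t) = lin_ext qscale lie.root.mixed t"
  by (simp add: from_HC_def module_hom.hom_lin_ext[OF module_hom_coset] coset_mixed_tns)

lemma H2_rels_finsupp: "H2_rels sc R0 R1 n \<subseteq> finsupp"
  unfolding H2_rels_eq by (rule lam_rels_finsupp)

lemma to_HC_rels: "t \<in> H2_rels sc R0 R1 n \<Longrightarrow> to_HC t \<in> HC1_rels sc R0 R1"
  using trace_cyclic.lin_ext_lam_rels[of t] coset_to_HC[of t UNIV] H2_rels_finsupp
  by (auto simp: H2_rels_eq simp flip: coset_HC1_rels_eq_0_iff)

lemma from_HC_rels: "v \<in> HC1_rels sc R0 R1 \<Longrightarrow> from_HC v \<in> H2_rels sc R0 R1 n"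
  using cyclic_pairing.lin_ext_lam_rels[OF lie.root.cyclic_pairing_mixed, of v] coset_from_HC[of v]
  by (simp add: HC1_rels_def flip: coset_H2_rels_eq_0_iff)

lemma coset_to_HC_mixed_tns: "coset (HC1_rels sc R0 R1) (to_HC (mixed_tns a b)) = cyclic_class a b"
proof -
  have "coset (HC1_rels sc R0 R1) (to_HC (mixed_tns a b))
      = odd_form cyclic_class (a, 0) (0, b) - odd_form cyclic_class (0, a * b) \<one>"
    unfolding coset_to_HC[OF mixed_tns_finsupp] unfolding mixed_tns_def
    by (simp add: quot.lin_ext_diff quot.lin_ext_tns finsupp_intros trace_pairing_elem
        odd_cyclic.zero_left odd_cyclic.zero_right)
  also have "\<dots> = cyclic_class a b - cyclic_class (a * b) e"
    by (simp add: odd_form_def cyclic.zero_left cyclic.zero_right)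
  also have "cyclic_class (a * b) e = 0"
    by (rule R.pairing_unit_right[OF cyclic.cyclic_pairing_axioms]) simp_all
  finally show ?thesis by simp
qed

lemma to_HC_from_HC:
  assumes "v \<in> finsupp"
  shows "to_HC (from_HC v) - v \<in> HC1_rels sc R0 R1"
proof -
  have "to_HC (from_HC v) = lin_ext fsc (\<lambda>a b. to_HC (mixed_tns a b)) v"
    by (simp add: to_HC_def from_HC_def fsc.lin_ext_lin_ext[OF mixed_tns_finsupp])
  then have "coset (HC1_rels sc R0 R1) (to_HC (from_HC v)) = lin_ext qscale cyclic_class v"
    by (simp add: module_hom.hom_lin_ext[OF module_hom_coset] coset_to_HC_mixed_tns)
  then show ?thesis
    using assms by (simp add: module_hom.diff[OF module_hom_coset] coset_HC1_rels
        flip: coset_HC1_rels_eq_0_iff)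
qed

lemma from_HC_to_HC:
  assumes "t \<in> pairs_mod L" "lie_boundary t = 0"
  shows "t - from_HC (to_HC t) \<in> H2_rels sc R0 R1 n"
proof -
  have "lin_ext qscale lie_class t
      = lin_ext qscale (\<lambda>X Y. lie.lift (M.bracket X Y) + trace_pairing (odd_form lie.root.mixed) X Y) t"
    using assms(1) by (rule quot.lin_ext_cong) (rule lie.splits)
  also have "\<dots> = lie.lift (lie_boundary t) + lin_ext qscale (trace_pairing (odd_form lie.root.mixed)) t"
    by (simp add: quot.lin_ext_plus lie.lift.hom_lin_ext)
  also have "\<dots> = coset (H2_rels sc R0 R1 n) (from_HC (to_HC t))"
    by (simp add: assms(2) coset_from_HC lin_ext_to_HC quot.module_axioms)
  finally show ?thesis
    by (simp add: module_hom.diff[OF module_hom_coset]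
        coset_H2_rels[OF pairs_mod_imp_finsupp[OF assms(1)]] flip: coset_H2_rels_eq_0_iff)
qed

subsection \<open>Degrees\<close>

lemma H2_deg_finsupp: "H2_deg sc R0 R1 n p \<subseteq> finsupp"
  unfolding H2_deg_def pairs_deg_def fsc.kspan_eq_span
  by (rule fsc.span_minimal) (auto simp: subspace_pairs_mod finsupp_intros)

lemma subspace_HC1_deg: "fsc.subspace (HC1_deg sc R0 R1 p)"
  by (simp add: HC1_deg_def pairs_deg_def fsc.kspan_eq_span)

lemma tns_in_HC1_deg: "rhom p a \<Longrightarrow> rhom q b \<Longrightarrow> tns a b \<in> HC1_deg sc R0 R1 (p \<noteq> q)"
  unfolding HC1_deg_def pairs_deg_def by (rule kspan.gen) blast

lemma trace_tns_in_HC1_deg: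
  assumes "X \<in> mhom p" "Y \<in> mhom q"
  shows "trace_pairing (odd_form tns) X Y \<in> HC1_deg sc R0 R1 (p = q)"
  unfolding trace_pairing_def odd_form_def
proof (intro fsc.subspace_sum fsc.subspace_add subspace_HC1_deg)
  fix i j assume "i \<in> {..<n}" "j \<in> {..<n}"
  then have "shom p (ent X i j)" "shom q (ent Y j i)" using assms by (auto intro: shom_ent)
  then have hom: "rhom p (fst (ent X i j))" "rhom (\<not> p) (snd (ent X i j))"
      "rhom q (fst (ent Y j i))" "rhom (\<not> q) (snd (ent Y j i))"
    by (simp_all add: shom_iff)
  show "tns (fst (ent X i j)) (snd (ent Y j i)) \<in> HC1_deg sc R0 R1 (p = q)"
    using tns_in_HC1_deg[OF hom(1,4)] by simp
  show "tns (snd (ent X i j)) (\<rho> (fst (ent Y j i))) \<in> HC1_deg sc R0 R1 (p = q)"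
    using tns_in_HC1_deg[OF hom(2) rhom_rho[OF hom(3)]] by simp
qed

lemma to_HC_deg:
  assumes "t \<in> H2_deg sc R0 R1 n p"
  shows "to_HC t \<in> HC1_deg sc R0 R1 (\<not> p)"
  unfolding to_HC_def
proof (rule fsc.lin_ext_kspan_in_subspace[OF subspace_HC1_deg
      assms[unfolded H2_deg_def pairs_deg_def]])
  fix g :: "'r mat \<times> 'r mat \<Rightarrow> 'k" assume "g \<in> {tns X Y | X Y q r. X \<in> L \<and> Y \<in> L \<and> hom L0 L1 q X
    \<and> hom L0 L1 r Y \<and> p = (q \<noteq> r)}"
  then obtain X Y q r where "g = tns X Y" "X \<in> mhom q" "Y \<in> mhom r" "p = (q \<noteq> r)"
    by (auto simp: hom_Int)
  then show "lin_ext fsc (trace_pairing (odd_form tns)) g \<in> HC1_deg sc R0 R1 (\<not> p)"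
    using trace_tns_in_HC1_deg[of X q Y r] by (simp add: fsc.lin_ext_tns)
qed (auto simp: finsupp_intros)

subsection \<open>Conclusion\<close>

lemma subspace_H2_cycles: "fsc.subspace (H2_cycles sc R0 R1 n)"
  by (rule fsc.subspaceI) (auto simp: H2_cycles_iff finsupp_intros M.lin_ext_0
      M.lin_ext_add M.lin_ext_fsc pairs_mod_imp_finsupp)

theorem H2_iso_HC1:
  "graded_iso_shift (H2_cycles sc R0 R1 n) (H2_rels sc R0 R1 n) (H2_deg sc R0 R1 n)
    (HC1_cycles sc R0 R1) (HC1_rels sc R0 R1) (HC1_deg sc R0 R1)"
proof (rule graded_iso_shiftI[where F = finsupp and f = to_HC and g = from_HC])
  show "fsc.subspace (H2_cycles sc R0 R1 n)" by (rule subspace_H2_cycles)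
  show "fsc.subspace (H2_rels sc R0 R1 n)" "fsc.subspace (HC1_rels sc R0 R1)"
    by (simp_all add: H2_rels_def HC1_rels_def subspace_lam_rels)
  show "H2_cycles sc R0 R1 n \<subseteq> finsupp"
    by (auto simp: H2_cycles_iff intro: pairs_mod_imp_finsupp)
next
  fix t assume "t \<in> H2_cycles sc R0 R1 n"
  then have t: "t \<in> pairs_mod L" "lie_boundary t = 0" by (simp_all add: H2_cycles_iff)
  then show "to_HC t \<in> HC1_cycles sc R0 R1"
    by (simp add: HC1_cycles_iff to_HC_finsupp cyclic_boundary_to_HC)
  show "t - from_HC (to_HC t) \<in> H2_rels sc R0 R1 n"
    using t by (rule from_HC_to_HC)
next
  fix v assume "v \<in> HC1_cycles sc R0 R1"
  then have v: "v \<in> finsupp" "cyclic_boundary v = 0" by (simp_all add: HC1_cycles_iff)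
  then show "from_HC v \<in> H2_cycles sc R0 R1 n"
    using elem.zero[of 0 0]
    by (simp add: H2_cycles_iff from_HC_pairs_mod lie_boundary_from_HC zero_prod_def)
  show "to_HC (from_HC v) - v \<in> HC1_rels sc R0 R1"
    using v(1) by (rule to_HC_from_HC)
qed (simp_all add: H2_rels_finsupp H2_deg_finsupp to_HC_add to_HC_diff to_HC_fsc to_HC_rels
    from_HC_rels to_HC_deg)

end

theorem theorem4p1:
  fixes sc :: "'k::comm_ring_1 \<Rightarrow> 'r::ring \<Rightarrow> 'r" and e :: 'r
    and R0 R1 :: "'r set" and n :: nat
  assumes "superalgebra sc e R0 R1"
    and "\<exists>u::'k. 2 * u = 1"
    and "3 \<le> n"
  shows "graded_iso_shift (H2_cycles sc R0 R1 n) (H2_rels sc R0 R1 n) (H2_deg sc R0 R1 n)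
                          (HC1_cycles sc R0 R1) (HC1_rels sc R0 R1) (HC1_deg sc R0 R1)"
proof -
  obtain u :: 'k where "2 * u = 1" using assms(2) by blast
  then interpret queer sc e R0 R1 n u using assms by unfold_locales
  show ?thesis by (rule H2_iso_HC1)
qed

end
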